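(* Let $\{\varphi^\varepsilon\}$ (indexed by $\varepsilon\to0$) be a bounded sequence in $L^2_{\rho^0}(\mathbb{R}^d)$. Then there exist a subsequence $\{\varphi^{\varepsilon'}\}$ and a function $\varphi^0\in L^2_{\rho^0}(\mathbb{R}^d\times Y)$ such that $\varphi^{\varepsilon'}$ two-scale converges to $\varphi^0$.
   Context: Let $d\ge1$, $\sigma>0$, $L>0$, $Y=[0,L]^d$. Let $V\in C^\infty(\mathbb{R}^d)$ be polynomially bounded from above and bounded from below, with constants $a,b>0$ such that $-\nabla V(x)\cdot x\le a-b|x|^2$ for all $x\in\mathbb{R}^d$, and let $\rho^0(x)=\frac1{C_{\rho^0}}e^{-\frac1\sigma V(x)}$ with $C_{\rho^0}=\int_{\mathbb{R}^d}e^{-\frac1\sigma V(x)}dx$. $L^2_{\rho^0}(\mathbb{R}^d)$ is the space of measurable $u$ with $\|u\|^2=\int_{\mathbb{R}^d}u^2\rho^0dx<\infty$. $L^2_{\rho^0}(\mathbb{R}^d\times Y)$ is the space of measurable $u\colon\mathbb{R}^d\times Y\to\mathbb{R}$ with $\int_{\mathbb{R}^d}\int_Yu(x,y)^2\rho^0(x)\,dy\,dx<\infty$. $C^0_{\mathrm{per}}(Y)$ is the space of continuous $Y$-periodic functions on $\mathbb{R}^d$. $L^2_{\rho^0}(\mathbb{R}^d;C^0_{\mathrm{per}}(Y))$ is the space of measurable functions $u\colon x\mapsto u(x)=u(x,\cdot)\in C^0_{\mathrm{per}}(Y)$ with $\int_{\mathbb{R}^d}\sup_{y\in Y}|u(x,y)|^2\rho^0(x)\,dx<\infty$.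 Two-scale convergence: a sequence $\{\varphi^\varepsilon\}$ in $L^2_{\rho^0}(\mathbb{R}^d)$ two-scale converges to $\varphi^0\in L^2_{\rho^0}(\mathbb{R}^d\times Y)$ if for every $\psi\in L^2_{\rho^0}(\mathbb{R}^d;C^0_{\mathrm{per}}(Y))$ $$\lim_{\varepsilon\to0}\int_{\mathbb{R}^d}\varphi^\varepsilon(x)\,\psi\!\left(x,\frac x\varepsilon\right)\rho^0(x)\,dx=\frac1{|Y|}\int_{\mathbb{R}^d}\int_Y\varphi^0(x,y)\psi(x,y)\rho^0(x)\,dy\,dx.$$ *)

theory Defs
  imports "HOL-Analysis.Analysis"
begin

definition grad :: "(real^'n \<Rightarrow> real) \<Rightarrow> real^'n \<Rightarrow> real^'n" where
  "grad f x = (\<chi> i. frechet_derivative f (at x) (axis i 1))"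

primrec Ck :: "nat \<Rightarrow> (real^'n \<Rightarrow> real) \<Rightarrow> bool" where
  "Ck 0 f \<longleftrightarrow> continuous_on UNIV f"
| "Ck (Suc k) f \<longleftrightarrow> (\<forall>x. f differentiable (at x)) \<and> (\<forall>i. Ck k (\<lambda>x. grad f x $ i))"

definition smooth :: "(real^'n \<Rightarrow> real) \<Rightarrow> bool" where
  "smooth f \<longleftrightarrow> (\<forall>k. Ck k f)"

definition poly_bounded_above :: "(real^'n \<Rightarrow> real) \<Rightarrow> bool" where
  "poly_bounded_above V \<longleftrightarrow> (\<exists>C (p::nat). \<forall>x. V x \<le> C * (1 + norm x ^ p))"

definition gibbs :: "real \<Rightarrow> (real^'n \<Rightarrow> real) \<Rightarrow> real^'n \<Rightarrow> real" where
  "gibbs \<sigma> V x = (1 / (LINT z|lebesgue. exp (- (1 / \<sigma>) * V z))) * exp (- (1 / \<sigma>) * V x)"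

text \<open>Below, \<open>\<rho>\<close> is an arbitrary nonnegative weight. Elements of the spaces are representatives;
  almost everywhere equal functions are not identified. Measurability is Lebesgue measurability.\<close>

definition cell :: "real \<Rightarrow> (real^'n) set" where
  "cell L = cbox 0 (\<chi> i. L)"

definition L2w :: "(real^'n \<Rightarrow> real) \<Rightarrow> (real^'n \<Rightarrow> real) set" where
  "L2w \<rho> = {u \<in> borel_measurable lebesgue. (\<integral>\<^sup>+x. ennreal ((u x)\<^sup>2 * \<rho> x) \<partial>lebesgue) < \<infinity>}"

definition L2w_norm :: "(real^'n \<Rightarrow> real) \<Rightarrow> (real^'n \<Rightarrow> real) \<Rightarrow> real" where
  "L2w_norm \<rho> u = sqrt (LINT x|lebesgue. (u x)\<^sup>2 * \<rho> x)"

definition L2w_cell :: "real \<Rightarrow> (real^'n \<Rightarrow> real) \<Rightarrow> ((real^'n) \<times> (real^'n) \<Rightarrow> real) set" where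
  "L2w_cell L \<rho> = {u \<in> borel_measurable (lebesgue_on (UNIV \<times> cell L)).
     (\<integral>\<^sup>+x. (\<integral>\<^sup>+y. ennreal ((u (x, y))\<^sup>2 * \<rho> x) \<partial>lebesgue_on (cell L)) \<partial>lebesgue) < \<infinity>}"

text \<open>A continuous periodic function is bounded, so nothing is lost by taking the periodic
  functions inside the type of bounded continuous functions. The norm of that type is the
  supremum norm, and it supplies the Borel sets used in \<open>L2w_C0per\<close> below.\<close>

definition C0per :: "real \<Rightarrow> ((real^'n) \<Rightarrow>\<^sub>C real) set" where
  "C0per L = {f. \<forall>i y. apply_bcontfun f (y + axis i L) = apply_bcontfun f y}"

text \<open>Measurability is that of the map \<open>x \<mapsto> u x\<close> into the Banach space \<open>C0per L\<close>. This space is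
  separable, so Borel and strong measurability agree.\<close>

definition L2w_C0per ::
    "real \<Rightarrow> (real^'n \<Rightarrow> real) \<Rightarrow> (real^'n \<Rightarrow> ((real^'n) \<Rightarrow>\<^sub>C real)) set" where
  "L2w_C0per L \<rho> = {u \<in> measurable lebesgue (restrict_space borel (C0per L)).
     (\<integral>\<^sup>+x. ennreal ((SUP y\<in>cell L. \<bar>apply_bcontfun (u x) y\<bar>\<^sup>2) * \<rho> x) \<partial>lebesgue) < \<infinity>}"

text \<open>A sequence indexed by small parameters is given by the parameters \<open>\<epsilon> n\<close>
  together with the functions \<open>\<phi> n\<close>.\<close>

definition two_scale_converges ::
    "real \<Rightarrow> (real^'n \<Rightarrow> real) \<Rightarrow> (nat \<Rightarrow> real) \<Rightarrow> (nat \<Rightarrow> real^'n \<Rightarrow> real)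
      \<Rightarrow> ((real^'n) \<times> (real^'n) \<Rightarrow> real) \<Rightarrow> bool" where
  "two_scale_converges L \<rho> \<epsilon> \<phi> \<phi>0 \<longleftrightarrow>
     (\<forall>n. \<phi> n \<in> L2w \<rho>) \<and> \<phi>0 \<in> L2w_cell L \<rho> \<and>
     (\<forall>\<psi>\<in>L2w_C0per L \<rho>.
       (\<lambda>n. LINT x|lebesgue. \<phi> n x * apply_bcontfun (\<psi> x) ((1 / \<epsilon> n) *\<^sub>R x) * \<rho> x)
       \<longlonglongrightarrow> 1 / measure lebesgue (cell L :: (real^'n) set) *
           (LINT x|lebesgue. LINT y|lebesgue_on (cell L).
              \<phi>0 (x, y) * apply_bcontfun (\<psi> x) y * \<rho> x))"

end

theory Submission
  imports Defs "HOL-Complex_Analysis.Great_Picard"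
begin

text \<open>Multiplying by \<open>sqrt \<rho>\<close> turns the weighted problem into one for a bounded sequence \<open>f n\<close> in the
  unweighted \<open>L\<^sup>2\<close>. The products of \<open>f n\<close> with the countably many oscillating grid indicators
  \<open>p (x / \<epsilon> n)\<close> have weak limits along a common subsequence, so \<open>\<integral> f n x * v (x, x / \<epsilon> n)\<close> has a
  limit \<open>F v\<close> for every \<open>v\<close> in the span of the products \<open>a x * p y\<close>. Since \<open>p (x / \<epsilon> n)\<close>
  converges weakly to the mean of \<open>p\<close>, Cauchy--Schwarz bounds \<open>F v\<close> by the \<open>L\<^sup>2\<close> norm of \<open>v\<close>, and the
  Riesz representation of \<open>F\<close> is the two-scale limit. A test function \<open>\<psi>\<close> is approximated by
  \<open>\<psi> x (grid_round y)\<close>, with an error at \<open>x\<close> controlled by the grid oscillation of \<open>\<psi> x\<close>.\<close>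

section \<open>Square-integrable functions and the Riesz representation\<close>

text \<open>A single subsequence must serve every test function, and traces along
  \<open>y = x / \<epsilon> n\<close> must be controlled although this graph is a null set of the
  product, so that closeness in \<open>L2\<close> of the product says nothing about them. Grid
  indicators in \<open>y\<close> answer both points. Only countably many periodic factors occur,
  while weak convergence treats all coefficients \<open>a x\<close> at once; and freezing
  \<open>\<psi> x\<close> at grid corners gives an exact finite sum of products
  \<open>a x * p y\<close>. The replacement error is bounded by a function of \<open>x\<close>
  alone, hence by the same bound on every trace and in the product, uniformly in \<open>n\<close>.
  This is where the supremum over \<open>y\<close> in the norm of the test functions enters. The
  discontinuity of the indicators is harmless, since the mean value limit asks for bounded Borel
  periodic functions. The factor \<open>1 / |Y|\<close> is absorbed by a uniform probability measure
  on the cell until the result is translated back to Lebesgue measure.\<close>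

definition L2 :: "'a measure \<Rightarrow> ('a \<Rightarrow> real) set" where
  "L2 M = {f \<in> borel_measurable M. integrable M (\<lambda>x. (f x)\<^sup>2)}"

lemma L2_measurable: "f \<in> L2 M \<Longrightarrow> f \<in> borel_measurable M"
  and L2_square: "f \<in> L2 M \<Longrightarrow> integrable M (\<lambda>x. (f x)\<^sup>2)"
  by (auto simp: L2_def)

lemma L2_dominated:
  assumes "g \<in> L2 M" "f \<in> borel_measurable M" "AE x in M. \<bar>f x\<bar> \<le> \<bar>g x\<bar>"
  shows "f \<in> L2 M" "(\<integral>x. (f x)\<^sup>2 \<partial>M) \<le> (\<integral>x. (g x)\<^sup>2 \<partial>M)"
proof -
  have ae: "AE x in M. (f x)\<^sup>2 \<le> (g x)\<^sup>2"
    using assms(3) by eventually_elim (simp add: abs_le_square_iff)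
  have i: "integrable M (\<lambda>x. (f x)\<^sup>2)"
    by (rule Bochner_Integration.integrable_bound[OF L2_square[OF assms(1)]])
       (use assms(2) ae in auto)
  then show "f \<in> L2 M" using assms(2) by (simp add: L2_def)
  show "(\<integral>x. (f x)\<^sup>2 \<partial>M) \<le> (\<integral>x. (g x)\<^sup>2 \<partial>M)"
    by (rule integral_mono_AE[OF i L2_square[OF assms(1)] ae])
qed

lemma L2_integrable_mult:
  assumes "f \<in> L2 M" "g \<in> L2 M"
  shows "integrable M (\<lambda>x. f x * g x)"
proof (rule Bochner_Integration.integrable_bound)
  show "integrable M (\<lambda>x. (f x)\<^sup>2 + (g x)\<^sup>2)"
    using assms by (auto simp: L2_def)
  show "(\<lambda>x. f x * g x) \<in> borel_measurable M"
    using assms by (auto simp: L2_def)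
  have "norm (f x * g x) \<le> norm ((f x)\<^sup>2 + (g x)\<^sup>2)" for x
  proof -
    have "2 * (\<bar>f x\<bar> * \<bar>g x\<bar>) \<le> (f x)\<^sup>2 + (g x)\<^sup>2"
      using sum_squares_bound[of "\<bar>f x\<bar>" "\<bar>g x\<bar>"] by (simp add: mult.assoc)
    moreover have "0 \<le> \<bar>f x\<bar> * \<bar>g x\<bar>" by simp
    ultimately have "\<bar>f x\<bar> * \<bar>g x\<bar> \<le> (f x)\<^sup>2 + (g x)\<^sup>2" by linarith
    then show ?thesis by (simp add: abs_mult)
  qed
  then show "AE x in M. norm (f x * g x) \<le> norm ((f x)\<^sup>2 + (g x)\<^sup>2)" by simp
qed

lemma L2_zero: "(\<lambda>x. 0) \<in> L2 M"
  by (simp add: L2_def)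

lemma L2_axpy:
  assumes "f \<in> L2 M" "g \<in> L2 M"
  shows "(\<lambda>x. c * f x + g x) \<in> L2 M"
proof -
  have "integrable M (\<lambda>x. c\<^sup>2 * (f x)\<^sup>2 + (2 * c * (f x * g x) + (g x)\<^sup>2))"
    using assms L2_integrable_mult[OF assms] by (auto simp: L2_def)
  also have "(\<lambda>x. c\<^sup>2 * (f x)\<^sup>2 + (2 * c * (f x * g x) + (g x)\<^sup>2)) = (\<lambda>x. (c * f x + g x)\<^sup>2)"
    by (auto simp: power2_eq_square algebra_simps)
  finally show ?thesis using assms by (auto simp: L2_def)
qed

lemma L2_cmult: "f \<in> L2 M \<Longrightarrow> (\<lambda>x. c * f x) \<in> L2 M"
  using L2_axpy[of f M "\<lambda>x. 0" c] by (simp add: L2_zero)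

lemma L2_diff: "f \<in> L2 M \<Longrightarrow> g \<in> L2 M \<Longrightarrow> (\<lambda>x. f x - g x) \<in> L2 M"
  using L2_axpy[of g M f "-1"] by simp

lemma integral_square_axpy:
  assumes "f \<in> L2 M" "g \<in> L2 M"
  shows "(\<integral>x. (c * f x + g x)\<^sup>2 \<partial>M)
    = c\<^sup>2 * (\<integral>x. (f x)\<^sup>2 \<partial>M) + 2 * c * (\<integral>x. f x * g x \<partial>M) + (\<integral>x. (g x)\<^sup>2 \<partial>M)"
proof -
  have "(\<integral>x. (c * f x + g x)\<^sup>2 \<partial>M) = (\<integral>x. c\<^sup>2 * (f x)\<^sup>2 + 2 * c * (f x * g x) + (g x)\<^sup>2 \<partial>M)"
    by (rule Bochner_Integration.integral_cong) (auto simp: power2_eq_square algebra_simps)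
  then show ?thesis
    using assms L2_integrable_mult[OF assms] by (simp add: L2_square)
qed

text \<open>The quadratic \<open>c\<^sup>2 * A + 2 * c * B + C\<close> is the integral of a square,
  so it is nonnegative for every \<open>c\<close>. For \<open>A > 0\<close> its minimiser
  \<open>- B / A\<close> gives \<open>B\<^sup>2 \<le> A * C\<close>; for \<open>A = 0\<close> it is
  affine in \<open>c\<close>, which forces \<open>B = 0\<close>.\<close>

lemma L2_Cauchy_Schwarz:
  assumes "f \<in> L2 M" "g \<in> L2 M"
  shows "\<bar>\<integral>x. f x * g x \<partial>M\<bar> \<le> sqrt (\<integral>x. (f x)\<^sup>2 \<partial>M) * sqrt (\<integral>x. (g x)\<^sup>2 \<partial>M)"
proof -
  define A where "A = (\<integral>x. (f x)\<^sup>2 \<partial>M)"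
  define B where "B = (\<integral>x. f x * g x \<partial>M)"
  define C where "C = (\<integral>x. (g x)\<^sup>2 \<partial>M)"
  have pos: "A \<ge> 0" "C \<ge> 0" by (simp_all add: A_def C_def)
  have q: "c\<^sup>2 * A + 2 * c * B + C \<ge> 0" for c
    unfolding A_def B_def C_def integral_square_axpy[OF assms, symmetric] by simp
  have "B\<^sup>2 \<le> A * C"
  proof (cases "A = 0")
    case True
    have "B = 0"
    proof (rule ccontr)
      assume "B \<noteq> 0"
      \<comment> \<open>At this \<open>c\<close> the affine expression \<open>2 * c * B + C\<close>
        equals \<open>-1\<close>.\<close>
      with q[of "- (C + 1) / (2 * B)"] True show False by (simp add: field_simps)
    qed
    with True show ?thesis by simp
  next
    case False
    then have "A > 0" using pos by simp
    with q[of "- B / A"] show ?thesis by (simp add: field_simps power2_eq_square)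
  qed
  then have "sqrt (B\<^sup>2) \<le> sqrt (A * C)" by (rule real_sqrt_le_mono)
  then have "\<bar>B\<bar> \<le> sqrt A * sqrt C" by (simp only: real_sqrt_abs real_sqrt_mult)
  then show ?thesis by (simp only: A_def B_def C_def)
qed

lemma L2_Cauchy_Schwarz_le:
  assumes "f \<in> L2 M" "g \<in> L2 M" "(\<integral>x. (f x)\<^sup>2 \<partial>M) \<le> a\<^sup>2" "(\<integral>x. (g x)\<^sup>2 \<partial>M) \<le> b\<^sup>2" "0 \<le> a" "0 \<le> b"
  shows "\<bar>\<integral>x. f x * g x \<partial>M\<bar> \<le> a * b"
proof -
  have "sqrt (\<integral>x. (f x)\<^sup>2 \<partial>M) \<le> a" "sqrt (\<integral>x. (g x)\<^sup>2 \<partial>M) \<le> b"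
    using assms real_le_lsqrt by (auto intro: real_le_lsqrt)
  then show ?thesis
    using L2_Cauchy_Schwarz[OF assms(1,2)] assms(5,6)
    by (smt (verit) mult_mono real_sqrt_ge_zero integral_nonneg_AE AE_I2 zero_le_power2)
qed

text \<open>The rate leaves room for the weight \<open>2 ^ k\<close>: the weighted squared
  increments have integrals at most \<open>(1/4) ^ k\<close>, so their sum is finite almost
  everywhere and the increments decay geometrically at almost every point. The weight replaces an
  \<open>L1\<close> estimate of the increments, which an \<open>L2\<close> bound does not provide on
  a space of infinite measure. Fatou's lemma then carries the rate over to the limit.\<close>

lemma L2_complete_fast:
  assumes w: "\<And>k. w k \<in> L2 M"
    and fast: "\<And>k m. k \<le> m \<Longrightarrow> (\<integral>x. (w m x - w k x)\<^sup>2 \<partial>M) \<le> (1/8) ^ k"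
  obtains f where "f \<in> L2 M" "\<And>k. (\<integral>x. (w k x - f x)\<^sup>2 \<partial>M) \<le> (1/8) ^ k"
proof -
  have [measurable]: "w k \<in> borel_measurable M" for k by (rule L2_measurable[OF w])
  have d: "integrable M (\<lambda>x. (w m x - w k x)\<^sup>2)" for m k
    by (rule L2_square[OF L2_diff[OF w w]])
  have "(\<integral>\<^sup>+x. (\<Sum>k. ennreal (2 ^ k * (w (Suc k) x - w k x)\<^sup>2)) \<partial>M)
      = (\<Sum>k. \<integral>\<^sup>+x. ennreal (2 ^ k * (w (Suc k) x - w k x)\<^sup>2) \<partial>M)"
    by (rule nn_integral_suminf) auto
  also have "\<dots> \<le> (\<Sum>k. ennreal ((1/4) ^ k))"
  proof (intro suminf_le)
    fix k
    have "(\<integral>\<^sup>+x. ennreal (2 ^ k * (w (Suc k) x - w k x)\<^sup>2) \<partial>M)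
        = ennreal (\<integral>x. 2 ^ k * (w (Suc k) x - w k x)\<^sup>2 \<partial>M)"
      by (rule nn_integral_eq_integral) (use d in auto)
    also have "\<dots> \<le> ennreal (2 ^ k * (1/8) ^ k)"
      using fast[of k "Suc k"] by (intro ennreal_leI) simp
    also have "(2::real) ^ k * (1/8) ^ k = (1/4) ^ k"
      by (simp flip: power_mult_distrib)
    finally show "(\<integral>\<^sup>+x. ennreal (2 ^ k * (w (Suc k) x - w k x)\<^sup>2) \<partial>M) \<le> ennreal ((1/4) ^ k)" .
  qed auto
  also have "\<dots> < \<infinity>"
    by (subst suminf_ennreal_eq[OF _ geometric_sums]) auto
  finally have "AE x in M. (\<Sum>k. ennreal (2 ^ k * (w (Suc k) x - w k x)\<^sup>2)) \<noteq> \<infinity>"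
    by (intro nn_integral_PInf_AE) auto
  then have conv: "AE x in M. convergent (\<lambda>k. w k x)"
  proof eventually_elim
    case (elim x)
    define d where "d k = w (Suc k) x - w k x" for k
    have "summable (\<lambda>k. 2 ^ k * (d k)\<^sup>2)"
      by (rule summable_suminf_not_top) (use elim in \<open>auto simp: d_def\<close>)
    \<comment> \<open>Boundedness of the weighted squares is all that is kept: it bounds
      \<open>d k\<close> by a geometric sequence of ratio \<open>sqrt (1/2) < 1\<close>.\<close>
    then have "Bseq (\<lambda>k. 2 ^ k * (d k)\<^sup>2)"
      using summable_LIMSEQ_zero convergent_imp_Bseq convergentI by blast
    then obtain C where C: "\<And>k. norm (2 ^ k * (d k)\<^sup>2) \<le> C" by (auto simp: Bseq_def)
    have "norm (d k) \<le> sqrt C * (sqrt (1/2)) ^ k" for k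
    proof -
      have "(d k)\<^sup>2 \<le> C * (1/2) ^ k"
        using C[of k] by (simp add: power_one_over field_simps)
      then have "sqrt ((d k)\<^sup>2) \<le> sqrt (C * (1/2) ^ k)" by (rule real_sqrt_le_mono)
      then have "\<bar>d k\<bar> \<le> sqrt (C * (1/2) ^ k)" by (simp only: real_sqrt_abs)
      then show ?thesis by (simp only: real_sqrt_mult real_sqrt_power real_norm_def)
    qed
    moreover have "summable (\<lambda>k. sqrt C * (sqrt (1/2)) ^ k)"
      by (intro summable_mult summable_geometric) simp
    ultimately have "summable d" by (rule summable_comparison_test'[rotated])
    then have "convergent (\<lambda>n. \<Sum>k<n. d k)" by (simp add: summable_iff_convergent)
    also have "(\<lambda>n. \<Sum>k<n. d k) = (\<lambda>n. w n x - w 0 x)"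
      unfolding d_def by (rule ext) (rule sum_lessThan_telescope)
    finally show ?case using convergent_diff_const_right_iff[of "\<lambda>n. w n x" "w 0 x"] by simp
  qed
  \<comment> \<open>Where the sequence diverges, \<open>lim\<close> has some fixed default value;
    this happens only on a null set and does not disturb measurability.\<close>
  define f where "f x = lim (\<lambda>k. w k x)" for x
  have [measurable]: "f \<in> borel_measurable M" unfolding f_def by measurable
  have le: "(\<integral>\<^sup>+x. ennreal ((w k x - f x)\<^sup>2) \<partial>M) \<le> ennreal ((1/8) ^ k)" for k
  proof -
    have "(\<integral>\<^sup>+x. ennreal ((w k x - f x)\<^sup>2) \<partial>M)
        \<le> (\<integral>\<^sup>+x. liminf (\<lambda>m. ennreal ((w m x - w k x)\<^sup>2)) \<partial>M)"
    proof (rule nn_integral_mono_AE)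
      show "AE x in M. ennreal ((w k x - f x)\<^sup>2) \<le> liminf (\<lambda>m. ennreal ((w m x - w k x)\<^sup>2))"
        using conv
      proof eventually_elim
        case (elim x)
        then have "(\<lambda>m. w m x) \<longlonglongrightarrow> f x" by (simp add: convergent_LIMSEQ_iff f_def)
        then have "(\<lambda>m. ennreal ((w m x - w k x)\<^sup>2)) \<longlonglongrightarrow> ennreal ((f x - w k x)\<^sup>2)"
          by (intro tendsto_intros) auto
        from lim_imp_Liminf[OF _ this] show ?case by (simp add: power2_commute)
      qed
    qed
    also have "\<dots> \<le> liminf (\<lambda>m. \<integral>\<^sup>+x. ennreal ((w m x - w k x)\<^sup>2) \<partial>M)"
      by (rule nn_integral_liminf) auto
    also have "\<dots> \<le> liminf (\<lambda>m. ennreal ((1/8) ^ k))"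
    proof (rule Liminf_mono)
      show "\<forall>\<^sub>F m in sequentially. (\<integral>\<^sup>+x. ennreal ((w m x - w k x)\<^sup>2) \<partial>M) \<le> ennreal ((1/8) ^ k)"
        using eventually_ge_at_top[of k]
      proof eventually_elim
        case (elim m)
        have "(\<integral>\<^sup>+x. ennreal ((w m x - w k x)\<^sup>2) \<partial>M) = ennreal (\<integral>x. (w m x - w k x)\<^sup>2 \<partial>M)"
          by (rule nn_integral_eq_integral) (use d in auto)
        with fast[OF elim] show ?case by (simp add: ennreal_leI)
      qed
    qed
    finally show ?thesis by (simp add: Liminf_const)
  qed
  have i: "integrable M (\<lambda>x. (w k x - f x)\<^sup>2)" for k
    by (rule integrableI_bounded) (use le_less_trans[OF le[of k] ennreal_less_top] in auto)
  then have "(\<lambda>x. w 0 x - f x) \<in> L2 M" by (simp add: L2_def)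
  then have fL: "f \<in> L2 M" using L2_diff[OF w[of 0]] by fastforce
  moreover have "(\<integral>x. (w k x - f x)\<^sup>2 \<partial>M) \<le> (1/8) ^ k" for k
    using le[of k] i[of k] by (subst (asm) nn_integral_eq_integral) auto
  ultimately show ?thesis by (rule that)
qed

section \<open>Linear spans of functions and the Riesz representation on them\<close>

inductive_set fspan :: "('a \<Rightarrow> real) set \<Rightarrow> ('a \<Rightarrow> real) set" for B where
  zero: "(\<lambda>x. 0) \<in> fspan B"
| step: "b \<in> B \<Longrightarrow> w \<in> fspan B \<Longrightarrow> (\<lambda>x. c * b x + w x) \<in> fspan B"

lemma fspan_axpy:
  assumes "v \<in> fspan B" "w \<in> fspan B"
  shows "(\<lambda>x. c * v x + w x) \<in> fspan B"
  using assms
proof (induction arbitrary: c)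
  case zero
  then show ?case by simp
next
  case (step b v d)
  from fspan.step[OF step(1) step(3)[OF step(4), of c], of "c * d"]
  show ?case by (simp add: algebra_simps)
qed

lemma fspan_base: "b \<in> B \<Longrightarrow> b \<in> fspan B"
  using fspan.step[of b B "\<lambda>x. 0" 1] by (simp add: fspan.zero)

lemma fspan_sum:
  assumes "finite I" "\<And>i. i \<in> I \<Longrightarrow> b i \<in> B"
  shows "(\<lambda>x. \<Sum>i\<in>I. b i x) \<in> fspan B"
  using assms
proof (induction rule: finite_induct)
  case empty
  then show ?case by (simp add: fspan.zero)
next
  case (insert i I)
  then have "(\<lambda>x. 1 * b i x + (\<Sum>i\<in>I. b i x)) \<in> fspan B"
    by (intro fspan.step) auto
  with insert show ?case by simp
qed

lemma fspan_L2:
  assumes "B \<subseteq> L2 M" "w \<in> fspan B"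
  shows "w \<in> L2 M"
  using assms(2) by induction (use assms(1) in \<open>auto intro: L2_zero L2_axpy\<close>)

text \<open>The representing function minimises \<open>\<parallel>w\<parallel>\<^sup>2 - 2 F w\<close>; the parallelogram identity makes
  a minimising sequence Cauchy.\<close>

lemma L2_Riesz:
  assumes B: "B \<subseteq> L2 M"
    and lin: "\<And>v w c. v \<in> fspan B \<Longrightarrow> w \<in> fspan B \<Longrightarrow> F (\<lambda>x. c * v x + w x) = c * F v + F w"
    and bnd: "\<And>w. w \<in> fspan B \<Longrightarrow> \<bar>F w\<bar> \<le> C * sqrt (\<integral>x. (w x)\<^sup>2 \<partial>M)"
  obtains f w where "f \<in> L2 M" "\<And>v. v \<in> fspan B \<Longrightarrow> F v = (\<integral>x. f x * v x \<partial>M)"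
    and "\<And>k::nat. w k \<in> fspan B" "(\<lambda>k. \<integral>x. (w k x - f x)\<^sup>2 \<partial>M) \<longlonglongrightarrow> 0"
proof -
  let ?W = "fspan B"
  have WL: "w \<in> L2 M" if "w \<in> ?W" for w using fspan_L2[OF B that] .
  define J where "J w = (\<integral>x. (w x)\<^sup>2 \<partial>M) - 2 * F w" for w
  define j where "j = Inf (J ` ?W)"
  have J_ge: "J w \<ge> - C\<^sup>2" if "w \<in> ?W" for w
  proof -
    \<comment> \<open>Completing the square: \<open>J w \<ge> n\<^sup>2 - 2 * C * n = (n -
      C)\<^sup>2 - C\<^sup>2\<close>.\<close>
    define n where "n = sqrt (\<integral>x. (w x)\<^sup>2 \<partial>M)"
    have "n\<^sup>2 = (\<integral>x. (w x)\<^sup>2 \<partial>M)" by (simp add: n_def)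
    moreover have "(n - C)\<^sup>2 \<ge> 0" by simp
    ultimately show ?thesis
      using bnd[OF that] unfolding J_def n_def[symmetric]
      by (simp add: power2_eq_square algebra_simps)
  qed
  have bdd: "bdd_below (J ` ?W)" using J_ge by (auto intro!: bdd_belowI2)
  have j_le: "j \<le> J w" if "w \<in> ?W" for w
    unfolding j_def by (rule cInf_lower[OF _ bdd]) (use that in auto)
  \<comment> \<open>The tolerance is tuned to the midpoint estimate below: half the squared distance
    of \<open>w m\<close> and \<open>w k\<close> will be less than
    \<open>((1/8) ^ m + (1/8) ^ k) / 4\<close>, which gives the rate that
    \<open>L2_complete_fast\<close> asks for.\<close>
  have "\<exists>w\<in>?W. J w < j + (1/8) ^ k / 4" for k :: nat
  proof -
    have "\<exists>y\<in>J ` ?W. y < j + (1/8) ^ k / 4"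
      unfolding j_def by (rule cInf_lessD) (use fspan.zero in auto)
    then show ?thesis by auto
  qed
  then obtain w where wW: "\<And>k. w k \<in> ?W" and wJ: "\<And>k::nat. J (w k) < j + (1/8) ^ k / 4"
    by metis
  have F0: "F (\<lambda>x. 0) = 0" using lin[OF fspan.zero fspan.zero, of 1] by simp
  \<comment> \<open>Along a line, \<open>J\<close> is a parabola whose slope at \<open>u\<close> in
    the direction \<open>v\<close> is twice the defect
    \<open>(\<integral>x. v x * u x \<partial>M) - F v\<close>. Minimality will force this defect to
    vanish in the limit.\<close>
  have expand: "J (\<lambda>x. c * v x + u x) = c\<^sup>2 * (\<integral>x. (v x)\<^sup>2 \<partial>M)
      + 2 * c * ((\<integral>x. v x * u x \<partial>M) - F v) + J u" if "v \<in> ?W" "u \<in> ?W" for c v u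
    unfolding J_def integral_square_axpy[OF WL[OF that(1)] WL[OF that(2)]] lin[OF that]
    by (simp add: algebra_simps)
  have "(\<integral>x. (w m x - w k x)\<^sup>2 \<partial>M) \<le> (1/8) ^ k" if "k \<le> m" for k m
  proof -
    let ?d = "\<lambda>x. (-1) * w k x + w m x"
    have dW: "?d \<in> ?W" using fspan_axpy wW by blast
    \<comment> \<open>The values \<open>1/2\<close> and \<open>1\<close> of \<open>c\<close> give
      the midpoint and the endpoint \<open>w m\<close>; eliminating the linear term between the two
      expansions is the parallelogram identity.\<close>
    have "j \<le> J (\<lambda>x. (1/2) * ?d x + w k x)" "J (\<lambda>x. 1 * ?d x + w k x) = J (w m)"
      by (rule j_le[OF fspan_axpy[OF dW wW]], rule arg_cong[where f=J]) auto
    then have "2 * j + (\<integral>x. (?d x)\<^sup>2 \<partial>M) / 2 \<le> J (w m) + J (w k)"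
      unfolding expand[OF dW wW] by (simp add: power2_eq_square algebra_simps)
    moreover have "(1/8::real) ^ m \<le> (1/8) ^ k" using that by (intro power_decreasing) auto
    moreover have "(\<integral>x. (?d x)\<^sup>2 \<partial>M) = (\<integral>x. (w m x - w k x)\<^sup>2 \<partial>M)" by simp
    ultimately show ?thesis using wJ[of m] wJ[of k] by linarith
  qed
  then obtain f where f: "f \<in> L2 M" and lim: "\<And>k. (\<integral>x. (w k x - f x)\<^sup>2 \<partial>M) \<le> (1/8) ^ k"
    using L2_complete_fast[of w M] WL wW by blast
  have lim0: "(\<lambda>k. \<integral>x. (w k x - f x)\<^sup>2 \<partial>M) \<longlonglongrightarrow> 0"
    by (rule tendsto_sandwich[OF _ _ tendsto_const LIMSEQ_power_zero[of "1/8::real"]])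
       (use lim in auto)
  have "F v = (\<integral>x. f x * v x \<partial>M)" if v: "v \<in> ?W" for v
  proof -
    define q where "q = (\<integral>x. (v x)\<^sup>2 \<partial>M)"
    define e where "e k = (\<integral>x. v x * w k x \<partial>M) - F v" for k
    have "(\<lambda>k. \<integral>x. v x * (w k x - f x) \<partial>M) \<longlonglongrightarrow> 0"
    proof (rule tendsto_rabs_zero_cancel, rule tendsto_sandwich[OF _ _ tendsto_const])
      show "\<forall>\<^sub>F k in sequentially. \<bar>\<integral>x. v x * (w k x - f x) \<partial>M\<bar>
          \<le> sqrt q * sqrt (\<integral>x. (w k x - f x)\<^sup>2 \<partial>M)"
        unfolding q_def using L2_Cauchy_Schwarz[OF WL[OF v] L2_diff[OF WL[OF wW] f]] by simp
      show "(\<lambda>k. sqrt q * sqrt (\<integral>x. (w k x - f x)\<^sup>2 \<partial>M)) \<longlonglongrightarrow> 0"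
        using tendsto_mult_right_zero[OF tendsto_real_sqrt[OF lim0, simplified]] by blast
    qed auto
    also have "(\<lambda>k. \<integral>x. v x * (w k x - f x) \<partial>M) = (\<lambda>k. e k + F v - (\<integral>x. f x * v x \<partial>M))"
      using L2_integrable_mult[OF WL[OF v] WL[OF wW]] L2_integrable_mult[OF WL[OF v] f]
      by (simp add: e_def right_diff_distrib mult.commute)
    finally have "(\<lambda>k. e k + F v - (\<integral>x. f x * v x \<partial>M) + ((\<integral>x. f x * v x \<partial>M) - F v)) 
        \<longlonglongrightarrow> 0 + ((\<integral>x. f x * v x \<partial>M) - F v)"
      by (intro tendsto_add tendsto_const)
    then have elim: "e \<longlonglongrightarrow> (\<integral>x. f x * v x \<partial>M) - F v" by simp
    \<comment> \<open>A displacement \<open>t * v\<close> of \<open>w k\<close> cannot lower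
      \<open>J\<close> by more than the tolerance; as \<open>k\<close> grows, the parabola in
      \<open>t\<close> is nonnegative.\<close>
    have "0 \<le> t\<^sup>2 * q + 2 * t * ((\<integral>x. f x * v x \<partial>M) - F v)" for t
    proof (rule LIMSEQ_le_const)
      show "(\<lambda>k. t\<^sup>2 * q + 2 * t * e k + (1/8) ^ k / 4)
          \<longlonglongrightarrow> t\<^sup>2 * q + 2 * t * ((\<integral>x. f x * v x \<partial>M) - F v)"
        by (rule tendsto_eq_intros elim LIMSEQ_power_zero refl | simp)+
      have "0 \<le> t\<^sup>2 * q + 2 * t * e k + (1/8) ^ k / 4" for k
        using j_le[OF fspan_axpy[OF v wW[of k]], of t] wJ[of k]
        unfolding expand[OF v wW] q_def e_def by linarith
      then show "\<exists>N. \<forall>k\<ge>N. 0 \<le> t\<^sup>2 * q + 2 * t * e k + (1/8) ^ k / 4" by blast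
    qed
    note quad = this
    define z where "z = (\<integral>x. f x * v x \<partial>M) - F v"
    have "q \<ge> 0" by (simp add: q_def)
    have "z = 0"
    proof (rule ccontr)
      assume "z \<noteq> 0"
      \<comment> \<open>Small enough for the linear term to beat the quadratic one, and still
        meaningful when \<open>q = 0\<close>.\<close>
      define t where "t = 1 / (q + 1)"
      have t: "t > 0" "t * q = 1 - t" using \<open>q \<ge> 0\<close> by (auto simp: t_def field_simps)
      have "0 \<le> (- t * z)\<^sup>2 * q + 2 * (- t * z) * z"
        using quad z_def by blast
      also have "\<dots> = (t * q - 2) * (t * z\<^sup>2)" by (simp add: power2_eq_square algebra_simps)
      also have "\<dots> < 0" using t \<open>z \<noteq> 0\<close> by (intro mult_neg_pos) auto
      finally show False by simp
    qed
    then show ?thesis by (simp add: z_def)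
  qed
  \<comment> \<open>The sequence \<open>w\<close> is handed out too: it records that
    \<open>f\<close> lies in the closure of the span, so that \<open>f\<close> can act as an
    orthogonal projection.\<close>
  from that[OF f this wW lim0] show ?thesis by blast
qed

text \<open>The error \<open>d N\<close> does not depend on \<open>n\<close>, which permits fixing
  \<open>N\<close> before \<open>n\<close> tends to infinity. In the application \<open>N\<close> is
  the grid level and \<open>n\<close> the index of the oscillation.\<close>

lemma tendsto_uniform_approx:
  fixes X :: "nat \<Rightarrow> real"
  assumes conv: "\<And>N. Y N \<longlonglongrightarrow> l N" and le: "\<And>N n. \<bar>X n - Y N n\<bar> \<le> d N"
    and le': "\<And>N. \<bar>l' - l N\<bar> \<le> d N" and d: "d \<longlonglongrightarrow> (0::real)"
  shows "X \<longlonglongrightarrow> l'"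
proof (rule LIMSEQ_I)
  fix e :: real assume "e > 0"
  then obtain N where N: "d N < e / 4"
    using order_tendstoD(2)[OF d, of "e/4"] by (auto simp: eventually_sequentially)
  obtain n0 where "\<forall>n\<ge>n0. \<bar>Y N n - l N\<bar> < e / 4"
    using LIMSEQ_D[OF conv[of N], of "e/4"] \<open>e > 0\<close> by auto
  moreover have "\<bar>X n - l'\<bar> < e" if "\<bar>Y N n - l N\<bar> < e / 4" for n
    using le[of n N] le'[of N] N that \<open>e > 0\<close> by linarith
  ultimately show "\<exists>n0. \<forall>n\<ge>n0. norm (X n - l') < e" by auto
qed

text \<open>It suffices to test against the span of the sequences
  themselves, onto which any other test function is projected by the Riesz representation.\<close>

lemma L2_weak_compactness:
  fixes H :: "'i \<Rightarrow> nat \<Rightarrow> 'a \<Rightarrow> real"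
  assumes K: "countable K" and H: "\<And>i n. i \<in> K \<Longrightarrow> H i n \<in> L2 M"
    and bnd: "\<And>i n. i \<in> K \<Longrightarrow> (\<integral>x. (H i n x)\<^sup>2 \<partial>M) \<le> C\<^sup>2" and C: "0 \<le> C"
  obtains r :: "nat \<Rightarrow> nat" where "strict_mono r"
    and "\<And>i g. i \<in> K \<Longrightarrow> g \<in> L2 M \<Longrightarrow> convergent (\<lambda>n. \<integral>x. H i (r n) x * g x \<partial>M)"
proof -
  have cnt: "countable (K \<times> K \<times> (UNIV :: nat set))" using K by simp
  \<comment> \<open>Only the pairings of the sequences with one another are made to converge
    directly: countably many bounded sequences of numbers, for which a diagonal argument
    suffices.\<close>
  define G where "G n z = (case z of (i, k, m) \<Rightarrow> \<integral>x. H i n x * H k m x \<partial>M)" for n z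
  have G: "norm (G n z) \<le> C * C" if "z \<in> K \<times> K \<times> UNIV" for n z
    using that L2_Cauchy_Schwarz_le[OF H H bnd bnd C C] by (auto simp: G_def split: prod.split)
  obtain r :: "nat \<Rightarrow> nat" where r: "strict_mono r"
    and conv: "\<And>z. z \<in> K \<times> K \<times> UNIV \<Longrightarrow> \<exists>l. (\<lambda>n. G (r n) z) \<longlonglongrightarrow> l"
  proof (rule function_convergent_subsequence[OF cnt, of G "C * C"])
    show "norm (G n z) \<le> C * C" if "z \<in> K \<times> K \<times> UNIV" for n z by (rule G[OF that])
    fix k :: "nat \<Rightarrow> nat"
    assume "strict_mono k" "\<And>z. z \<in> K \<times> K \<times> UNIV \<Longrightarrow> \<exists>l. (\<lambda>n. G (k n) z) \<longlonglongrightarrow> l"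
    then show thesis by (rule that)
  qed
  define B where "B = {H k m |k m. k \<in> K}"
  have B: "B \<subseteq> L2 M" using H by (auto simp: B_def)
  have cspan: "convergent (\<lambda>n. \<integral>x. H i (r n) x * w x \<partial>M)" if i: "i \<in> K" and w: "w \<in> fspan B" for i w
    using w
  proof induction
    case zero
    then show ?case by (simp add: convergent_const)
  next
    case (step b w c)
    then have "convergent (\<lambda>n. \<integral>x. H i (r n) x * b x \<partial>M)"
      using conv i by (fastforce simp: B_def G_def convergent_def)
    then have "convergent (\<lambda>n. c * (\<integral>x. H i (r n) x * b x \<partial>M) + (\<integral>x. H i (r n) x * w x \<partial>M))"
      by (intro convergent_add convergent_mult convergent_const step.IH)
    also have "(\<lambda>n. c * (\<integral>x. H i (r n) x * b x \<partial>M) + (\<integral>x. H i (r n) x * w x \<partial>M))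
      = (\<lambda>n. \<integral>x. H i (r n) x * (c * b x + w x) \<partial>M)"
    proof
      fix n
      have "integrable M (\<lambda>x. H i (r n) x * b x)" "integrable M (\<lambda>x. H i (r n) x * w x)"
        using step.hyps B fspan_L2[OF B] i by (auto intro!: L2_integrable_mult H)
      then show "c * (\<integral>x. H i (r n) x * b x \<partial>M) + (\<integral>x. H i (r n) x * w x \<partial>M)
        = (\<integral>x. H i (r n) x * (c * b x + w x) \<partial>M)"
        by (simp add: distrib_left mult.left_commute)
    qed
    finally show ?case .
  qed
  have "convergent (\<lambda>n. \<integral>x. H i (r n) x * g x \<partial>M)" if i: "i \<in> K" and g: "g \<in> L2 M" for i g
  proof -
    have "(\<integral>x. g x * (c * v x + w x) \<partial>M) = c * (\<integral>x. g x * v x \<partial>M) + (\<integral>x. g x * w x \<partial>M)"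
      if "v \<in> fspan B" "w \<in> fspan B" for v w c
      using L2_integrable_mult[OF g fspan_L2[OF B that(1)]] L2_integrable_mult[OF g fspan_L2[OF B that(2)]]
      by (simp add: distrib_left mult.left_commute)
    note lin = this
    \<comment> \<open>Riesz, applied on the span to the pairing with \<open>g\<close>, gives the
      projection \<open>p\<close> of \<open>g\<close> onto the closure of the span. Each
      \<open>H i (r n)\<close> lies in \<open>B\<close>, so it has the same pairing with
      \<open>g\<close> as with \<open>p\<close>, and \<open>p\<close> is a limit of span elements
      whose pairings converge.\<close>
    obtain p w where p: "p \<in> L2 M" and eq: "\<And>v. v \<in> fspan B \<Longrightarrow> (\<integral>x. g x * v x \<partial>M) = (\<integral>x. p x * v x \<partial>M)"
      and w: "\<And>k::nat. w k \<in> fspan B" and lim: "(\<lambda>k. \<integral>x. (w k x - p x)\<^sup>2 \<partial>M) \<longlonglongrightarrow> 0"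
    proof (rule L2_Riesz[OF B lin L2_Cauchy_Schwarz[OF g fspan_L2[OF B]]])
      fix f and w :: "nat \<Rightarrow> 'a \<Rightarrow> real"
      assume "f \<in> L2 M" "\<And>v. v \<in> fspan B \<Longrightarrow> (\<integral>x. g x * v x \<partial>M) = (\<integral>x. f x * v x \<partial>M)"
        "\<And>k. w k \<in> fspan B" "(\<lambda>k. \<integral>x. (w k x - f x)\<^sup>2 \<partial>M) \<longlonglongrightarrow> 0"
      then show thesis by (rule that)
    qed
    define d where "d k = C * sqrt (\<integral>x. (w k x - p x)\<^sup>2 \<partial>M)" for k
    have d0: "d \<longlonglongrightarrow> 0"
      unfolding d_def using tendsto_mult_right_zero[OF tendsto_real_sqrt[OF lim, simplified]] by blast
    define X where "X n = (\<integral>x. H i (r n) x * g x \<partial>M)" for n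
    have Xp: "X n = (\<integral>x. H i (r n) x * p x \<partial>M)" for n
      using eq[of "H i (r n)"] fspan_base[of "H i (r n)" B] i unfolding X_def
      by (auto simp: B_def mult.commute)
    define Y where "Y k n = (\<integral>x. H i (r n) x * w k x \<partial>M)" for k n
    have wL: "w k \<in> L2 M" for k by (rule fspan_L2[OF B w])
    have XY: "\<bar>X n - Y k n\<bar> \<le> d k" for n k
    proof -
      have "Y k n - X n = (\<integral>x. H i (r n) x * (w k x - p x) \<partial>M)"
        unfolding Xp Y_def using L2_integrable_mult[OF H[OF i] wL] L2_integrable_mult[OF H[OF i] p]
        by (simp add: right_diff_distrib)
      also have "\<bar>\<dots>\<bar> \<le> d k"
        unfolding d_def by (rule L2_Cauchy_Schwarz_le[OF H[OF i] L2_diff[OF wL p] bnd[OF i] _ C]) auto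
      finally show ?thesis by linarith
    qed
    have "Cauchy X"
    proof (rule metric_CauchyI)
      fix e :: real assume "e > 0"
      then obtain k where k: "d k < e / 4"
        using order_tendstoD(2)[OF d0, of "e/4"] by (auto simp: eventually_sequentially)
      have "Cauchy (Y k)" using cspan[OF i w, of k] by (simp add: Y_def[abs_def] Cauchy_convergent_iff)
      have lt: "dist (X m) (X n) < e" if "dist (Y k m) (Y k n) < e / 4" for m n
        using XY[of m k] XY[of n k] k that unfolding dist_real_def by linarith
      from \<open>Cauchy (Y k)\<close> obtain n0 where "\<forall>m\<ge>n0. \<forall>n\<ge>n0. dist (Y k m) (Y k n) < e / 4"
        using \<open>e > 0\<close> unfolding Cauchy_def by (meson zero_less_divide_iff zero_less_numeral)
      then show "\<exists>n0. \<forall>m\<ge>n0. \<forall>n\<ge>n0. dist (X m) (X n) < e"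
        by (intro exI[of _ n0] allI impI) (use lt in blast)
    qed
    then show ?thesis by (simp add: X_def[abs_def] Cauchy_convergent_iff)
  qed
  with r show ?thesis by (rule that)
qed

section \<open>Translations and oscillating functions\<close>

lemma integral_lborel_translate:
  fixes f :: "'a::euclidean_space \<Rightarrow> real"
  assumes "f \<in> borel_measurable borel"
  shows "(\<integral>x. f (x + c) \<partial>lborel) = (\<integral>x. f x \<partial>lborel)"
proof -
  have "(\<integral>x. f x \<partial>lborel) = (\<integral>x. f x \<partial>distr lborel borel ((+) c))"
    by (simp add: lborel_distr_plus)
  also have "\<dots> = (\<integral>x. f (c + x) \<partial>lborel)"
    using assms by (intro integral_distr) auto
  finally show ?thesis by (simp add: add.commute)
qed

lemma integrable_lborel_translate:
  fixes f :: "'a::euclidean_space \<Rightarrow> real"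
  assumes "integrable lborel f"
  shows "integrable lborel (\<lambda>x. f (x + c))"
proof -
  have "integrable (distr lborel borel ((+) c)) f"
    using assms by (simp add: lborel_distr_plus)
  then have "integrable lborel (\<lambda>x. f (c + x))"
    by (rule integrable_distr[rotated]) simp
  then show ?thesis by (simp add: add.commute)
qed

text \<open>The functions are compared both at \<open>x + c\<close> and at \<open>x\<close>; by
  translation invariance the two errors have the same integral, hence the factor 2.\<close>

lemma L1_translation_triangle:
  fixes f g :: "'a::euclidean_space \<Rightarrow> real"
  assumes f: "integrable lborel f" and g: "integrable lborel g"
  shows "(\<integral>x. \<bar>f (x + c) - f x\<bar> \<partial>lborel)
    \<le> (\<integral>x. \<bar>g (x + c) - g x\<bar> \<partial>lborel) + 2 * (\<integral>x. \<bar>f x - g x\<bar> \<partial>lborel)"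
proof -
  note [simp] = f g integrable_lborel_translate[OF f, of c] integrable_lborel_translate[OF g, of c]
  have "(\<integral>x. \<bar>f (x + c) - f x\<bar> \<partial>lborel)
    \<le> (\<integral>x. \<bar>g (x + c) - g x\<bar> + (\<bar>f (x + c) - g (x + c)\<bar> + \<bar>f x - g x\<bar>) \<partial>lborel)"
    by (rule integral_mono) auto
  also have "\<dots> = (\<integral>x. \<bar>g (x + c) - g x\<bar> \<partial>lborel)
      + ((\<integral>x. \<bar>f (x + c) - g (x + c)\<bar> \<partial>lborel) + (\<integral>x. \<bar>f x - g x\<bar> \<partial>lborel))"
    by simp
  also have "(\<integral>x. \<bar>f (x + c) - g (x + c)\<bar> \<partial>lborel) = (\<integral>x. \<bar>f x - g x\<bar> \<partial>lborel)"
    using borel_measurable_integrable[OF f] borel_measurable_integrable[OF g]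
    by (intro integral_lborel_translate) auto
  finally show ?thesis by simp
qed

text \<open>Shifted indicators need not converge at boundary points of \<open>A\<close>, but their
  products with the indicator of \<open>A\<close> do converge everywhere, by openness inside
  \<open>A\<close> and trivially outside. The \<open>L1\<close> distance is expressed through the
  integral of this product, because translation preserves the measure of \<open>A\<close>.\<close>

lemma open_translation_continuous:
  fixes A :: "'a::euclidean_space set" and h :: "nat \<Rightarrow> 'a"
  assumes A: "open A" "emeasure lborel A < \<infinity>" and h: "h \<longlonglongrightarrow> 0"
  shows "(\<lambda>n. \<integral>x. \<bar>indicator A (x + h n) - indicator A x\<bar> \<partial>lborel) \<longlonglongrightarrow> (0::real)"
proof -
  let ?i = "indicator A :: 'a \<Rightarrow> real"
  have [measurable]: "A \<in> sets borel" using A by simp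
  have i: "integrable lborel ?i" using A by (simp add: integrable_indicator_iff)
  note i' = integrable_lborel_translate[OF i]
  have ii: "integrable lborel (\<lambda>x. ?i x * ?i (x + h n))" for n
    by (rule Bochner_Integration.integrable_bound[OF i]) (auto split: split_indicator)
  have "(\<lambda>n. \<integral>x. ?i x * ?i (x + h n) \<partial>lborel) \<longlonglongrightarrow> (\<integral>x. ?i x \<partial>lborel)"
  proof (rule integral_dominated_convergence[OF _ _ i])
    show "AE x in lborel. (\<lambda>n. ?i x * ?i (x + h n)) \<longlonglongrightarrow> ?i x"
    proof (intro AE_I2)
      fix x
      show "(\<lambda>n. ?i x * ?i (x + h n)) \<longlonglongrightarrow> ?i x"
      proof (cases "x \<in> A")
        case True
        have "(\<lambda>n. x + h n) \<longlonglongrightarrow> x" using tendsto_add[OF tendsto_const h, of x] by simp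
        then have "\<forall>\<^sub>F n in sequentially. x + h n \<in> A"
          using A(1) True by (rule topological_tendstoD)
        then have "\<forall>\<^sub>F n in sequentially. ?i x * ?i (x + h n) = ?i x"
          by eventually_elim (simp add: True)
        then show ?thesis by (rule tendsto_eventually)
      qed simp
    qed
  qed (auto split: split_indicator)
  then have "(\<lambda>n. 2 * (\<integral>x. ?i x \<partial>lborel) - 2 * (\<integral>x. ?i x * ?i (x + h n) \<partial>lborel))
      \<longlonglongrightarrow> 2 * (\<integral>x. ?i x \<partial>lborel) - 2 * (\<integral>x. ?i x \<partial>lborel)"
    by (intro tendsto_intros)
  moreover have "(\<integral>x. \<bar>?i (x + h n) - ?i x\<bar> \<partial>lborel)
      = 2 * (\<integral>x. ?i x \<partial>lborel) - 2 * (\<integral>x. ?i x * ?i (x + h n) \<partial>lborel)" for n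
  proof -
    have "(\<integral>x. \<bar>?i (x + h n) - ?i x\<bar> \<partial>lborel)
        = (\<integral>x. ?i (x + h n) + ?i x - 2 * (?i x * ?i (x + h n)) \<partial>lborel)"
      by (rule Bochner_Integration.integral_cong) (auto split: split_indicator)
    also have "\<dots> = (\<integral>x. ?i (x + h n) \<partial>lborel) + (\<integral>x. ?i x \<partial>lborel) - 2 * (\<integral>x. ?i x * ?i (x + h n) \<partial>lborel)"
      using i i' ii by simp
    also have "(\<integral>x. ?i (x + h n) \<partial>lborel) = (\<integral>x. ?i x \<partial>lborel)"
      by (rule integral_lborel_translate) simp
    finally show ?thesis by simp
  qed
  ultimately show ?thesis by simp
qed

text \<open>Integrable functions are generated from indicators by sums and dominated pointwise
  limits. Outer regularity replaces the set of an indicator by an open one.\<close>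

lemma L1_translation_continuous:
  fixes f :: "'a::euclidean_space \<Rightarrow> real" and h :: "nat \<Rightarrow> 'a"
  assumes f: "integrable lborel f" and h: "h \<longlonglongrightarrow> 0"
  shows "(\<lambda>n. \<integral>x. \<bar>f (x + h n) - f x\<bar> \<partial>lborel) \<longlonglongrightarrow> 0"
proof -
  \<comment> \<open>Stability under \<open>L1\<close> approximation is stated for an arbitrary
    \<open>f\<close>, since both the indicator case and the limit case rely on it.\<close>
  have approx: "(\<lambda>n. \<integral>x. \<bar>f (x + h n) - f x\<bar> \<partial>lborel) \<longlonglongrightarrow> 0"
    if f: "integrable lborel f"
      and ex: "\<And>e. e > 0 \<Longrightarrow> \<exists>g. integrable lborel g \<and> (\<integral>x. \<bar>f x - g x\<bar> \<partial>lborel) < e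
        \<and> (\<lambda>n. \<integral>x. \<bar>g (x + h n) - g x\<bar> \<partial>lborel) \<longlonglongrightarrow> 0"
    for f :: "'a \<Rightarrow> real"
  proof (rule LIMSEQ_I)
    fix e :: real assume "e > 0"
    then obtain g where g: "integrable lborel g" "(\<integral>x. \<bar>f x - g x\<bar> \<partial>lborel) < e / 4"
      and lim: "(\<lambda>n. \<integral>x. \<bar>g (x + h n) - g x\<bar> \<partial>lborel) \<longlonglongrightarrow> 0"
      using ex[of "e/4"] by auto
    from LIMSEQ_D[OF lim, of "e/2"] \<open>e > 0\<close>
    obtain n0 where n0: "\<And>n. n \<ge> n0 \<Longrightarrow> (\<integral>x. \<bar>g (x + h n) - g x\<bar> \<partial>lborel) < e / 2" by auto
    have "(\<integral>x. \<bar>f (x + h n) - f x\<bar> \<partial>lborel) < e" if "n \<ge> n0" for n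
      using L1_translation_triangle[OF f g(1), of "h n"] g(2) n0[OF that] by linarith
    then show "\<exists>n0. \<forall>n\<ge>n0. norm ((\<integral>x. \<bar>f (x + h n) - f x\<bar> \<partial>lborel) - 0) < e"
      by (auto intro!: exI[of _ n0])
  qed
  from f show ?thesis
  proof induction
    case (base A c)
    have [measurable]: "A \<in> sets borel" using base by simp
    show ?case
    proof (rule approx)
      show "integrable lborel (\<lambda>x. indicator A x *\<^sub>R c)"
        using base by (simp add: integrable_indicator_iff)
      fix e :: real assume "e > 0"
      \<comment> \<open>The \<open>+ 1\<close> allows \<open>c = 0\<close> and makes
        \<open>e' * \<bar>c\<bar> < e\<close> strict.\<close>
      define e' where "e' = e / (\<bar>c\<bar> + 1)"
      have e': "e' > 0" "e' * \<bar>c\<bar> < e" using \<open>e > 0\<close> by (auto simp: e'_def field_simps)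
      obtain T where T: "open T" "A \<subseteq> T" "emeasure lborel (T - A) < ennreal e'"
        using outer_regular_lborel[of A e'] e' by auto
      have [measurable]: "T \<in> sets borel" using T by simp
      have "emeasure lborel T \<le> emeasure lborel A + emeasure lborel (T - A)"
        using T(2) emeasure_subadditive[of A lborel "T - A"] by (simp add: Un_absorb1)
      also have "\<dots> < \<infinity>" using base T(3) by (auto simp: less_top[symmetric] ennreal_add_eq_top)
      finally have Tf: "emeasure lborel T < \<infinity>" .
      have i: "integrable lborel (\<lambda>x. c * indicator T x)"
        using Tf by (simp add: integrable_indicator_iff)
      have "(\<integral>x. \<bar>indicator A x *\<^sub>R c - c * indicator T x\<bar> \<partial>lborel) = (\<integral>x. \<bar>c\<bar> * indicator (T - A) x \<partial>lborel)"
        by (rule Bochner_Integration.integral_cong) (use T(2) in \<open>auto split: split_indicator\<close>)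
      also have "\<dots> = \<bar>c\<bar> * measure lborel (T - A)" by simp
      also have "\<dots> \<le> \<bar>c\<bar> * e'"
        using T(3) e'(1) by (intro mult_left_mono) (auto simp: measure_def enn2real_leI less_imp_le)
      also have "\<dots> < e" using e'(2) by (simp add: mult.commute)
      finally have 1: "(\<integral>x. \<bar>indicator A x *\<^sub>R c - c * indicator T x\<bar> \<partial>lborel) < e" .
      have "(\<lambda>n. \<bar>c\<bar> * (\<integral>x. \<bar>indicator T (x + h n) - indicator T x\<bar> \<partial>lborel)) \<longlonglongrightarrow> 0"
        using open_translation_continuous[OF T(1) Tf h] by (rule tendsto_mult_right_zero)
      then have "(\<lambda>n. \<integral>x. \<bar>c * indicator T (x + h n) - c * indicator T x\<bar> \<partial>lborel) \<longlonglongrightarrow> 0"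
        by (simp flip: right_diff_distrib add: abs_mult)
      with i 1 show "\<exists>g. integrable lborel g \<and> (\<integral>x. \<bar>indicator A x *\<^sub>R c - g x\<bar> \<partial>lborel) < e
          \<and> (\<lambda>n. \<integral>x. \<bar>g (x + h n) - g x\<bar> \<partial>lborel) \<longlonglongrightarrow> 0"
        by blast
    qed
  next
    case (add f g)
    show ?case
    proof (rule tendsto_sandwich[OF _ _ tendsto_const])
      show "(\<lambda>n. (\<integral>x. \<bar>f (x + h n) - f x\<bar> \<partial>lborel) + (\<integral>x. \<bar>g (x + h n) - g x\<bar> \<partial>lborel)) \<longlonglongrightarrow> 0"
        using tendsto_add[OF add.IH] by simp
      have "(\<integral>x. \<bar>f (x + h n) + g (x + h n) - (f x + g x)\<bar> \<partial>lborel)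
          \<le> (\<integral>x. \<bar>f (x + h n) - f x\<bar> \<partial>lborel) + (\<integral>x. \<bar>g (x + h n) - g x\<bar> \<partial>lborel)" for n
      proof -
        note [simp] = add.hyps add.hyps[THEN integrable_lborel_translate, of "h n"]
        have "(\<integral>x. \<bar>f (x + h n) + g (x + h n) - (f x + g x)\<bar> \<partial>lborel)
          \<le> (\<integral>x. \<bar>f (x + h n) - f x\<bar> + \<bar>g (x + h n) - g x\<bar> \<partial>lborel)"
          by (rule integral_mono) auto
        then show ?thesis by simp
      qed
      then show "\<forall>\<^sub>F n in sequentially. (\<integral>x. \<bar>f (x + h n) + g (x + h n) - (f x + g x)\<bar> \<partial>lborel)
          \<le> (\<integral>x. \<bar>f (x + h n) - f x\<bar> \<partial>lborel) + (\<integral>x. \<bar>g (x + h n) - g x\<bar> \<partial>lborel)" by simp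
    qed auto
  next
    case (lim f s)
    show ?case
    proof (rule approx[OF lim.hyps(4)])
      fix e :: real assume "e > 0"
      have "(\<lambda>i. \<integral>x. \<bar>f x - s i x\<bar> \<partial>lborel) \<longlonglongrightarrow> (\<integral>x. 0 \<partial>(lborel :: 'a measure))"
      \<comment> \<open>The induction rule supplies approximants bounded by
        \<open>2 * \<bar>f x\<bar>\<close>, whence the factor 3.\<close>
      proof (rule integral_dominated_convergence[where w="\<lambda>x. 3 * \<bar>f x\<bar>"])
        show "AE x in lborel. (\<lambda>i. \<bar>f x - s i x\<bar>) \<longlonglongrightarrow> 0"
        proof (intro AE_I2)
          fix x
          from tendsto_rabs[OF tendsto_diff[OF tendsto_const lim.hyps(2)[of x]], of "f x"]
          show "(\<lambda>i. \<bar>f x - s i x\<bar>) \<longlonglongrightarrow> 0" by simp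
        qed
        have "\<bar>f x - s i x\<bar> \<le> 3 * \<bar>f x\<bar>" for i x
          using lim.hyps(3)[of x i] by (simp add: abs_if split: if_splits)
        then show "AE x in lborel. norm \<bar>f x - s i x\<bar> \<le> 3 * \<bar>f x\<bar>" for i by simp
      qed (use lim.hyps in auto)
      then obtain i where "(\<integral>x. \<bar>f x - s i x\<bar> \<partial>lborel) < e"
        using order_tendstoD(2)[of _ 0 sequentially e] \<open>e > 0\<close> by (auto simp: eventually_sequentially)
      with lim.hyps(1)[of i] lim.IH[of i]
      show "\<exists>g. integrable lborel g \<and> (\<integral>x. \<bar>f x - g x\<bar> \<partial>lborel) < e
        \<and> (\<lambda>n. \<integral>x. \<bar>g (x + h n) - g x\<bar> \<partial>lborel) \<longlonglongrightarrow> 0" by blast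
    qed
  qed
qed

section \<open>Periodic functions and integration over the period cell\<close>

definition period_rem :: "real \<Rightarrow> real^'n \<Rightarrow> real^'n" where
  "period_rem L y = (\<chi> i. L * frac (y $ i / L))"

lemma periodic_axis_multiple:
  fixes f :: "real^'n \<Rightarrow> 'b"
  assumes per: "\<And>i y. f (y + axis i L) = f y"
  shows "f (y + axis i (of_int k * L)) = f y"
proof -
  have nat: "f (y + axis i (real m * L)) = f y" for m y
  proof (induction m)
    case (Suc m)
    have "y + axis i (real (Suc m) * L) = (y + axis i (real m * L)) + axis i L"
      by (simp add: vec_eq_iff axis_def algebra_simps)
    then show ?case by (simp only: per Suc)
  qed (simp add: axis_def vec_eq_iff[symmetric] flip: zero_vec_def)
  show ?thesis
  proof (cases "k \<ge> 0")
    case True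
    then show ?thesis using nat[of y "nat k"] by simp
  next
    case False
    have "(y + axis i (of_int k * L)) + axis i (real (nat (- k)) * L) = y"
      using False by (simp add: vec_eq_iff axis_def)
    with nat[of "y + axis i (of_int k * L)" "nat (- k)"] show ?thesis by simp
  qed
qed

lemma vec_sum_axis: "(\<Sum>i\<in>UNIV. axis i (x $ i)) = (x :: real^'n)"
  by (simp add: vec_eq_iff axis_def if_distrib cong: if_cong)

text \<open>\<open>period_rem L y\<close> is the representative of \<open>y\<close> modulo the
  period lattice. The integer multiples of \<open>L\<close> by which it differs from
  \<open>y\<close> are removed one coordinate at a time, by induction over a finite set of
  coordinates.\<close>

lemma periodic_period_rem:
  fixes f :: "real^'n \<Rightarrow> 'b"
  assumes L: "L > 0" and per: "\<And>i y. f (y + axis i L) = f y"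
  shows "f (period_rem L y) = f y"
proof -
  have "f (y + (\<Sum>i\<in>S. axis i (of_int (- \<lfloor>y $ i / L\<rfloor>) * L))) = f y" if "finite S" for S
    using that
  proof induction
    case (insert j S)
    have "y + (\<Sum>i\<in>insert j S. axis i (of_int (- \<lfloor>y $ i / L\<rfloor>) * L))
      = (y + (\<Sum>i\<in>S. axis i (of_int (- \<lfloor>y $ i / L\<rfloor>) * L))) + axis j (of_int (- \<lfloor>y $ j / L\<rfloor>) * L)"
      using insert by simp
    then show ?case by (simp only: periodic_axis_multiple[of f L, OF per] insert.IH)
  qed simp
  from this[OF finite] have "f (y + (\<Sum>i\<in>UNIV. axis i (of_int (- \<lfloor>y $ i / L\<rfloor>) * L))) = f y" .
  moreover have "y + (\<Sum>i\<in>UNIV. axis i (of_int (- \<lfloor>y $ i / L\<rfloor>) * L)) = period_rem L y"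
    using L vec_sum_axis[of "\<chi> i. of_int (- \<lfloor>y $ i / L\<rfloor>) * L"]
    by (simp add: vec_eq_iff period_rem_def frac_def field_simps)
  ultimately show ?thesis by simp
qed

lemma period_rem_bounds: "L > 0 \<Longrightarrow> 0 \<le> period_rem L y $ i \<and> period_rem L y $ i < L"
  using frac_lt_1[of "y $ i / L"] by (simp add: period_rem_def)

lemma period_rem_in_cell: "L > 0 \<Longrightarrow> period_rem L y \<in> cell L"
  using period_rem_bounds[of L y] by (auto simp: cell_def mem_box_cart less_imp_le)

text \<open>The closed cell contains opposite faces that coincide modulo the period. Without the
  upper faces every class has exactly one representative, so that a shifted cell can be cut and
  reassembled exactly.\<close>

definition halfopen_cell :: "real \<Rightarrow> (real^'n) set" where
  "halfopen_cell L = {y. \<forall>i. 0 \<le> y $ i \<and> y $ i < L}"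

lemma halfopen_cell_borel [measurable]: "halfopen_cell L \<in> sets borel"
proof -
  have "halfopen_cell L = (\<Inter>i. {y. 0 \<le> y $ i} \<inter> {y. y $ i < L})" by (auto simp: halfopen_cell_def)
  also have "\<dots> \<in> sets borel"
    by (intro sets.finite_INT sets.Int borel_closed borel_open closed_Collect_le open_Collect_less
        continuous_intros) auto
  finally show ?thesis .
qed

lemma cell_borel [measurable]: "cell L \<in> sets borel"
  by (simp add: cell_def)

lemma measure_cell_pos: "L > 0 \<Longrightarrow> measure lborel (cell L :: (real^'n) set) > 0"
  unfolding cell_def by (rule content_pos_lt) (auto simp: Basis_vec_def inner_axis)

lemma emeasure_cell: "emeasure lborel (cell L :: (real^'n) set) = ennreal (measure lborel (cell L :: (real^'n) set))"
  unfolding cell_def by (intro emeasure_eq_ennreal_measure) (use emeasure_lborel_cbox_finite in \<open>auto simp: less_top\<close>)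

lemma AE_halfopen_cell:
  "AE y in lborel. y \<in> cell L \<longleftrightarrow> y \<in> (halfopen_cell L :: (real^'n) set)"
proof -
  have "{y :: real^'n. y $ i = L} \<in> null_sets lborel" for i
  proof -
    have "negligible {y :: real^'n. y \<bullet> axis i 1 = L}"
      by (rule negligible_standard_hyperplane) (simp add: axis_in_Basis_iff)
    then have "{y :: real^'n. y $ i = L} \<in> null_sets (completion lborel)"
      by (simp add: inner_axis negligible_iff_null_sets)
    moreover have "{y :: real^'n. y $ i = L} \<in> sets lborel"
      unfolding sets_lborel by (intro borel_closed closed_Collect_eq continuous_intros)
    ultimately show ?thesis using null_sets_completion_iff by blast
  qed
  then have "AE y in lborel. \<forall>i. (y :: real^'n) $ i \<noteq> L"
    unfolding AE_all_countable using AE_not_in by fastforce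
  then show ?thesis
    by eventually_elim (auto simp: cell_def halfopen_cell_def mem_box_cart less_le)
qed

lemma integrable_halfopen_cell:
  fixes p :: "real^'n \<Rightarrow> real"
  assumes [measurable]: "p \<in> borel_measurable borel" and p: "\<And>y. \<bar>p y\<bar> \<le> C"
    and [measurable]: "A \<in> sets borel" and A: "A \<subseteq> halfopen_cell L"
  shows "integrable lborel (\<lambda>y. indicator A y * p y)"
proof (rule Bochner_Integration.integrable_bound)
  show "integrable lborel (\<lambda>y. C * indicator (cell L :: (real^'n) set) y)"
    by (auto simp: integrable_indicator_iff emeasure_cell)
  have "norm (indicator A y * p y) \<le> norm (C * indicator (cell L) y)" for y
    using p[of y] A by (auto simp: cell_def halfopen_cell_def mem_box_cart less_imp_le split: split_indicator)
  then show "AE y in lborel. norm (indicator A y * p y) \<le> norm (C * indicator (cell L) y)" by simp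
qed measurable

text \<open>Modulo the period the shift is some \<open>s\<close> with \<open>0 \<le> s < L\<close>.
  The part \<open>A\<close> of the cell receives the points that stay in the cell under translation
  by \<open>s\<close>; the part \<open>B\<close> receives the remaining ones, wrapped around by
  \<open>s - L\<close>. Periodicity makes the two translations indistinguishable for
  \<open>p\<close>, and each preserves Lebesgue measure.\<close>

lemma integral_halfopen_cell_shift_axis:
  fixes p :: "real^'n \<Rightarrow> real"
  assumes L: "L > 0" and p_meas [measurable]: "p \<in> borel_measurable borel" and p: "\<And>y. \<bar>p y\<bar> \<le> C"
    and per: "\<And>i y. p (y + axis i L) = p y"
  shows "(\<integral>y. indicator (halfopen_cell L) y * p (y + axis i t) \<partial>lborel)
    = (\<integral>y. indicator (halfopen_cell L) y * p y \<partial>lborel)"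
proof -
  define s where "s = L * frac (t / L)"
  have s: "0 \<le> s" "s < L" using L frac_lt_1[of "t/L"] by (auto simp: s_def)
  let ?H = "halfopen_cell L :: (real^'n) set"
  define A where "A = ?H \<inter> {y. s \<le> y $ i}"
  define B where "B = ?H \<inter> {y. y $ i < s}"
  have [measurable]: "A \<in> sets borel" "B \<in> sets borel"
    unfolding A_def B_def
    by (intro sets.Int halfopen_cell_borel borel_closed borel_open closed_Collect_le open_Collect_less
        continuous_intros)+
  have int: "integrable lborel (\<lambda>y. indicator D y * p y)" if "D \<in> {A, B}" for D
    by (rule integrable_halfopen_cell[OF p_meas p]) (use that in \<open>auto simp: A_def B_def\<close>)
  have shift: "p (y + axis i t) = p (y + axis i s)" "p (y + axis i t) = p (y + axis i (s - L))" for y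
  proof -
    have t: "t = s + of_int \<lfloor>t / L\<rfloor> * L" using L by (simp add: s_def frac_def field_simps)
    have "y + axis i t = (y + axis i s) + axis i (of_int \<lfloor>t / L\<rfloor> * L)"
      by (subst t) (simp add: vec_eq_iff axis_def)
    then show 1: "p (y + axis i t) = p (y + axis i s)"
      by (simp only: periodic_axis_multiple[of p L, OF per])
    have 2: "y + axis i s = (y + axis i (s - L)) + axis i L" by (simp add: vec_eq_iff axis_def)
    show "p (y + axis i t) = p (y + axis i (s - L))" unfolding 1 by (subst 2) (rule per)
  qed
  have split: "indicator ?H y * p (y + axis i t) = indicator A (y + axis i s) * p (y + axis i s)
      + indicator B (y + axis i (s - L)) * p (y + axis i (s - L))" for y
  proof -
    have "indicator ?H y = indicator A (y + axis i s) + (indicator B (y + axis i (s - L)) :: real)"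
    proof -
      have comp: "(y + axis i c) $ j = y $ j + (if j = i then c else 0)" for c j
        by (simp add: axis_def)
      have all: "(\<forall>j. P j) \<longleftrightarrow> (\<forall>j. j \<noteq> i \<longrightarrow> P j) \<and> P i" for P and i :: 'n by auto
      have iff: "y + axis i c \<in> ?H \<longleftrightarrow> (\<forall>j. j \<noteq> i \<longrightarrow> 0 \<le> y $ j \<and> y $ j < L) \<and> 0 \<le> y $ i + c \<and> y $ i + c < L" for c
        unfolding halfopen_cell_def mem_Collect_eq comp by (subst all[where i=i]) auto
      have H0: "y \<in> ?H \<longleftrightarrow> (\<forall>j. j \<noteq> i \<longrightarrow> 0 \<le> y $ j \<and> y $ j < L) \<and> 0 \<le> y $ i \<and> y $ i < L"
        unfolding halfopen_cell_def mem_Collect_eq by (subst all[where i=i]) auto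
      have "y + axis i s \<in> A \<longleftrightarrow> y \<in> ?H \<and> y $ i < L - s"
        unfolding A_def Int_iff mem_Collect_eq comp iff H0 using s by auto
      moreover have "y + axis i (s - L) \<in> B \<longleftrightarrow> y \<in> ?H \<and> \<not> y $ i < L - s"
        unfolding B_def Int_iff mem_Collect_eq comp iff H0 using s by auto
      ultimately show ?thesis by (auto split: split_indicator)
    qed
    then show ?thesis using shift[of y] by (simp add: distrib_right)
  qed
  have "(\<integral>y. indicator ?H y * p (y + axis i t) \<partial>lborel)
      = (\<integral>y. indicator A (y + axis i s) * p (y + axis i s) \<partial>lborel)
      + (\<integral>y. indicator B (y + axis i (s - L)) * p (y + axis i (s - L)) \<partial>lborel)"
    unfolding split
    using int[of A, THEN integrable_lborel_translate] int[of B, THEN integrable_lborel_translate] by simp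
  also have "\<dots> = (\<integral>y. indicator A y * p y \<partial>lborel) + (\<integral>y. indicator B y * p y \<partial>lborel)"
    using integral_lborel_translate[of "\<lambda>y. indicator A y * p y"]
      integral_lborel_translate[of "\<lambda>y. indicator B y * p y"] by simp
  also have "\<dots> = (\<integral>y. indicator A y * p y + indicator B y * p y \<partial>lborel)"
    using int by simp
  also have "\<dots> = (\<integral>y. indicator ?H y * p y \<partial>lborel)"
    by (rule Bochner_Integration.integral_cong) (auto simp: A_def B_def split: split_indicator)
  finally show ?thesis .
qed

lemma integral_halfopen_cell_shift:
  fixes p :: "real^'n \<Rightarrow> real"
  assumes L: "L > 0" and p_meas [measurable]: "p \<in> borel_measurable borel" and p: "\<And>y. \<bar>p y\<bar> \<le> C"
    and per: "\<And>i y. p (y + axis i L) = p y"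
  shows "(\<integral>y. indicator (halfopen_cell L) y * p (y + z) \<partial>lborel)
    = (\<integral>y. indicator (halfopen_cell L) y * p y \<partial>lborel)"
proof -
  have "(\<integral>y. indicator (halfopen_cell L) y * p (y + (\<Sum>i\<in>S. axis i (z $ i))) \<partial>lborel)
    = (\<integral>y. indicator (halfopen_cell L) y * p y \<partial>lborel)" if "finite S" for S
    using that
  proof induction
    case (insert j S)
    let ?q = "\<lambda>y. p (y + (\<Sum>i\<in>S. axis i (z $ i)))"
    have "(\<integral>y. indicator (halfopen_cell L) y * ?q (y + axis j (z $ j)) \<partial>lborel)
      = (\<integral>y. indicator (halfopen_cell L) y * ?q y \<partial>lborel)"
    proof (rule integral_halfopen_cell_shift_axis[OF L])
      show "?q (y + axis i L) = ?q y" for i y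
        using per[of "y + (\<Sum>i\<in>S. axis i (z $ i))" i] by (simp add: ac_simps)
    qed (use p in auto)
    with insert show ?case by (simp add: add.assoc)
  qed simp
  from this[of UNIV] show ?thesis by (simp add: vec_sum_axis)
qed

text \<open>For \<open>L > 0\<close> a probability measure, so that cell averages become plain
  integrals and functions of \<open>x\<close> alone keep their norm in the product. It lives on the
  Borel sets of the whole space, and products with it are Lebesgue in \<open>x\<close> and Borel in
  \<open>y\<close>.\<close>

abbreviation unif_cell :: "real \<Rightarrow> (real^'n) measure" where
  "unif_cell L \<equiv> uniform_measure lborel (cell L)"

lemma emeasure_unif_cell: "L > 0 \<Longrightarrow> emeasure (unif_cell L) (UNIV :: (real^'n) set) = 1"
  using measure_cell_pos[of L, where 'n='n] emeasure_cell[of L, where 'n='n]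
  by (simp add: divide_ennreal)

lemma finite_measure_unif_cell: "L > 0 \<Longrightarrow> finite_measure (unif_cell L :: (real^'n) measure)"
  using emeasure_unif_cell[of L, where 'n='n] by (intro finite_measureI) simp

lemma integral_unif_cell:
  fixes p :: "real^'n \<Rightarrow> real"
  assumes L: "L > 0" and [measurable]: "p \<in> borel_measurable borel"
  shows "(\<integral>y. p y \<partial>unif_cell L)
    = (1 / measure lborel (cell L :: (real^'n) set)) * (\<integral>y. indicator (cell L) y * p y \<partial>lborel)"
proof -
  let ?m = "measure lborel (cell L :: (real^'n) set)"
  have "indicator (cell L) y / emeasure lborel (cell L :: (real^'n) set) = ennreal (indicator (cell L) y / ?m)" for y :: "real^'n"
    using measure_cell_pos[OF L, where 'n='n]
    by (auto simp: emeasure_cell divide_ennreal split: split_indicator simp flip: ennreal_1)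
  then have "(\<integral>y. p y \<partial>unif_cell L) = (\<integral>y. (indicator (cell L) y / ?m) * p y \<partial>lborel)"
    by (simp add: uniform_measure_def integral_density)
  also have "\<dots> = (\<integral>y. (1 / ?m) * (indicator (cell L) y * p y) \<partial>lborel)"
    by (rule Bochner_Integration.integral_cong) auto
  finally show ?thesis by simp
qed

lemma integral_unif_cell_shift:
  fixes p :: "real^'n \<Rightarrow> real"
  assumes L: "L > 0" and [measurable]: "p \<in> borel_measurable borel" and p: "\<And>y. \<bar>p y\<bar> \<le> C"
    and per: "\<And>i y. p (y + axis i L) = p y"
  shows "(\<integral>y. p (y + z) \<partial>unif_cell L) = (\<integral>y. p y \<partial>unif_cell L)"
proof -
  have eq: "(\<integral>y. indicator (cell L) y * q y \<partial>lborel) = (\<integral>y. indicator (halfopen_cell L) y * q y \<partial>lborel)"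
    if [measurable]: "q \<in> borel_measurable borel" for q :: "real^'n \<Rightarrow> real"
  proof (rule integral_cong_AE)
    show "AE y in lborel. indicator (cell L) y * q y = indicator (halfopen_cell L) y * q y"
      using AE_halfopen_cell[of L] by eventually_elim (auto split: split_indicator)
  qed measurable
  show ?thesis
    using integral_halfopen_cell_shift[OF assms] by (simp add: integral_unif_cell[OF L] eq)
qed

section \<open>Mean value limits of oscillating functions\<close>

lemma integrable_pair_fst:
  fixes k :: "'a \<Rightarrow> real"
  assumes M: "sigma_finite_measure M" and N: "finite_measure N" "emeasure N (space N) = 1"
    and k: "integrable M k"
  shows "integrable (M \<Otimes>\<^sub>M N) (\<lambda>z. k (fst z))"
    and "(\<integral>z. k (fst z) \<partial>(M \<Otimes>\<^sub>M N)) = (\<integral>x. k x \<partial>M)"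
proof -
  interpret M: sigma_finite_measure M by (rule M)
  interpret N: finite_measure N by (rule N)
  interpret MN: pair_sigma_finite M N ..
  have [measurable]: "k \<in> borel_measurable M" using k by simp
  have "(\<integral>\<^sup>+z. ennreal (norm (k (fst z))) \<partial>(M \<Otimes>\<^sub>M N)) = (\<integral>\<^sup>+x. \<integral>\<^sup>+y. ennreal (norm (k x)) \<partial>N \<partial>M)"
    by (subst N.nn_integral_fst[symmetric]) auto
  also have "\<dots> < \<infinity>" using k N(2) by (simp add: integrable_iff_bounded)
  finally show i: "integrable (M \<Otimes>\<^sub>M N) (\<lambda>z. k (fst z))" by (intro integrableI_bounded) auto
  have "(\<integral>z. k (fst z) \<partial>(M \<Otimes>\<^sub>M N)) = (\<integral>x. \<integral>y. k x \<partial>N \<partial>M)"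
    using MN.integral_fst'[OF i] by simp
  also have "\<dots> = (\<integral>x. k x \<partial>M)" using N(2) by (simp add: measure_def)
  finally show "(\<integral>z. k (fst z) \<partial>(M \<Otimes>\<^sub>M N)) = (\<integral>x. k x \<partial>M)" .
qed

text \<open>A shift of the fast variable by \<open>s\<close> costs only the \<open>L\<^sup>1\<close> distance between \<open>f\<close> and its
  translate by \<open>\<epsilon> s\<close>; averaging over \<open>s\<close> in the cell replaces the oscillating factor by its mean.\<close>

lemma oscillation_limit_lborel:
  fixes f p :: "real^'n \<Rightarrow> real"
  assumes L: "L > 0" and eps: "\<And>n. \<epsilon> n > 0" "\<epsilon> \<longlonglongrightarrow> (0::real)"
    and f: "integrable lborel f"
    and p_meas [measurable]: "p \<in> borel_measurable borel" and p: "\<And>y. \<bar>p y\<bar> \<le> C"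
    and per: "\<And>i y. p (y + axis i L) = p y"
  shows "(\<lambda>n. \<integral>x. f x * p ((1 / \<epsilon> n) *\<^sub>R x) \<partial>lborel) \<longlonglongrightarrow> (\<integral>x. f x \<partial>lborel) * (\<integral>y. p y \<partial>unif_cell L)"
proof -
  let ?U = "unif_cell L :: (real^'n) measure"
  interpret U: finite_measure ?U by (rule finite_measure_unif_cell[OF L])
  interpret Q: pair_sigma_finite "lborel :: (real^'n) measure" ?U ..
  have Usp: "emeasure ?U (space ?U) = 1" using emeasure_unif_cell[OF L] by simp
  have Um: "measure ?U (space ?U) = 1" using Usp by (simp only: measure_def) simp
  have [measurable]: "f \<in> borel_measurable borel" using borel_measurable_integrable[OF f] by simp
  have C: "C \<ge> 0" using p[of 0] by linarith
  define m where "m = (\<integral>y. p y \<partial>?U)"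
  define T where "T n = (\<integral>x. f x * p ((1 / \<epsilon> n) *\<^sub>R x) \<partial>lborel)" for n
  define D where "D n s = (\<integral>x. \<bar>f (x + - (\<epsilon> n *\<^sub>R s)) - f x\<bar> \<partial>lborel)" for n s
  have D_meas [measurable]: "D n \<in> borel_measurable borel" for n
    unfolding D_def by measurable
  \<comment> \<open>Comparison with the zero function bounds \<open>D n s\<close> independently of
    \<open>n\<close> and \<open>s\<close>, so a constant dominates on the finite measure
    \<open>?U\<close>.\<close>
  have D_le: "\<bar>D n s\<bar> \<le> 2 * (\<integral>x. \<bar>f x\<bar> \<partial>lborel)" for n s
    using L1_translation_triangle[OF f integrable_zero, of "- (\<epsilon> n *\<^sub>R s)"] by (simp add: D_def)
  have "(\<lambda>n. \<integral>s. D n s \<partial>?U) \<longlonglongrightarrow> (\<integral>s. 0 \<partial>?U)"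
  proof (rule integral_dominated_convergence[where w="\<lambda>s. 2 * (\<integral>x. \<bar>f x\<bar> \<partial>lborel)"])
    show "AE s in ?U. (\<lambda>n. D n s) \<longlonglongrightarrow> 0"
    proof (intro AE_I2)
      fix s :: "real^'n"
      have "(\<lambda>n. - (\<epsilon> n *\<^sub>R s)) \<longlonglongrightarrow> 0" using eps(2) by (auto intro!: tendsto_eq_intros)
      from L1_translation_continuous[OF f this] show "(\<lambda>n. D n s) \<longlonglongrightarrow> 0" by (simp add: D_def)
    qed
  qed (use D_le in auto)
  then have "(\<lambda>n. C * (\<integral>s. D n s \<partial>?U)) \<longlonglongrightarrow> 0" using tendsto_mult_right_zero by fastforce
  moreover have "\<bar>T n - (\<integral>x. f x \<partial>lborel) * m\<bar> \<le> C * (\<integral>s. D n s \<partial>?U)" for n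
  proof -
    define e where "e = \<epsilon> n"
    have e: "e > 0" using eps by (simp add: e_def)
    \<comment> \<open>Integrated in \<open>s\<close>, this gives \<open>f x\<close> times the mean
      of \<open>p\<close>, by shift invariance of the cell average; integrated in \<open>x\<close>,
      it gives \<open>T n\<close> up to \<open>C * D n s\<close>. Fubini links the two.\<close>
    define G where "G x s = f x * p ((1 / e) *\<^sub>R x + s)" for x s
    have iG: "integrable (lborel \<Otimes>\<^sub>M ?U) (case_prod G)"
    proof (rule Bochner_Integration.integrable_bound)
      show "integrable (lborel \<Otimes>\<^sub>M ?U) (\<lambda>z. C * f (fst z))"
        using integrable_pair_fst(1)[OF _ U.finite_measure_axioms Usp f] by (simp add: lborel.sigma_finite_measure_axioms)
      show "case_prod G \<in> borel_measurable (lborel \<Otimes>\<^sub>M ?U)" unfolding G_def by measurable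
      have "norm (G x s) \<le> norm (C * f x)" for x s
        using mult_left_mono[OF p[of "(1 / e) *\<^sub>R x + s"], of "\<bar>f x\<bar>"] C by (simp add: G_def abs_mult mult.commute)
      then show "AE z in lborel \<Otimes>\<^sub>M ?U. norm (case_prod G z) \<le> norm (C * f (fst z))"
        by (auto simp: case_prod_unfold)
    qed
    have inner: "(\<integral>s. G x s \<partial>?U) = f x * m" for x
      using integral_unif_cell_shift[OF L p_meas p per, of "(1 / e) *\<^sub>R x"] by (simp add: G_def m_def add.commute)
    have A: "(\<integral>x. f x \<partial>lborel) * m = (\<integral>s. \<integral>x. G x s \<partial>lborel \<partial>?U)"
      unfolding Q.Fubini_integral[OF iG] inner by simp
    have iA: "integrable ?U (\<lambda>s. \<integral>x. G x s \<partial>lborel)"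
      using Q.integrable_snd[OF iG] by simp
    have le: "\<bar>T n - (\<integral>x. G x s \<partial>lborel)\<bar> \<le> C * D n s" for s
    proof -
      have i1: "integrable lborel (\<lambda>x. g x * p ((1 / e) *\<^sub>R x))" if g: "integrable lborel g" for g :: "real^'n \<Rightarrow> real"
      proof (rule Bochner_Integration.integrable_bound)
        show "integrable lborel (\<lambda>x. C * g x)" using g by simp
        have [measurable]: "g \<in> borel_measurable borel" using borel_measurable_integrable[OF g] by simp
        show "(\<lambda>x. g x * p ((1 / e) *\<^sub>R x)) \<in> borel_measurable lborel" by measurable
        show "AE x in lborel. norm (g x * p ((1 / e) *\<^sub>R x)) \<le> norm (C * g x)"
          using C mult_right_mono[OF p] by (intro AE_I2) (simp add: abs_mult mult.commute[of "\<bar>g _\<bar>"])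
      qed
      let ?f = "\<lambda>x. f (x + - (e *\<^sub>R s))"
      have if': "integrable lborel ?f" by (rule integrable_lborel_translate[OF f])
      \<comment> \<open>Translation by \<open>e *\<^sub>R s\<close> moves the shift from the
        argument of \<open>p\<close> to that of \<open>f\<close>, where it is small with
        \<open>e\<close>.\<close>
      have "(\<integral>x. G x s \<partial>lborel) = (\<integral>x. ?f x * p ((1 / e) *\<^sub>R x) \<partial>lborel)"
        using integral_lborel_translate[of "\<lambda>x. ?f x * p ((1 / e) *\<^sub>R x)" "e *\<^sub>R s"] e
        by (simp add: G_def scaleR_add_right)
      then have "T n - (\<integral>x. G x s \<partial>lborel) = (\<integral>x. (f x - ?f x) * p ((1 / e) *\<^sub>R x) \<partial>lborel)"
        using i1[OF f] i1[OF if'] by (simp add: T_def e_def left_diff_distrib)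
      also have "\<bar>\<dots>\<bar> \<le> (\<integral>x. C * \<bar>?f x - f x\<bar> \<partial>lborel)"
      proof (rule order_trans[OF integral_abs_bound integral_mono])
        show "integrable lborel (\<lambda>x. \<bar>(f x - ?f x) * p ((1 / e) *\<^sub>R x)\<bar>)"
          using i1[of "\<lambda>x. f x - ?f x"] f if' by simp
        show "integrable lborel (\<lambda>x. C * \<bar>?f x - f x\<bar>)" using f if' by simp
        show "\<bar>(f x - ?f x) * p ((1 / e) *\<^sub>R x)\<bar> \<le> C * \<bar>?f x - f x\<bar>" for x
          using mult_left_mono[OF p[of "(1 / e) *\<^sub>R x"], of "\<bar>f x - ?f x\<bar>"]
          by (simp only: abs_mult abs_minus_commute[of "f x"] mult.commute[of C] abs_ge_zero)
      qed
      also have "\<dots> = C * D n s" by (simp add: D_def e_def)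
      finally show ?thesis .
    qed
    have "T n - (\<integral>x. f x \<partial>lborel) * m = (\<integral>s. T n - (\<integral>x. G x s \<partial>lborel) \<partial>?U)"
      using iA Um by (simp add: A)
    also have "\<bar>\<dots>\<bar> \<le> (\<integral>s. C * D n s \<partial>?U)"
    proof (rule order_trans[OF integral_abs_bound integral_mono])
      show "integrable ?U (\<lambda>s. \<bar>T n - (\<integral>x. G x s \<partial>lborel)\<bar>)" using iA by simp
      show "integrable ?U (\<lambda>s. C * D n s)"
        by (intro integrable_mult_right U.integrable_const_bound[where B="2 * (\<integral>x. \<bar>f x\<bar> \<partial>lborel)"]) (use D_le in auto)
    qed (rule le)
    finally show ?thesis by simp
  qed
  ultimately have "(\<lambda>n. T n - (\<integral>x. f x \<partial>lborel) * m) \<longlonglongrightarrow> 0"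
    by (intro tendsto_rabs_zero_cancel[of "\<lambda>n. T n - _"])
      (rule tendsto_sandwich[OF _ _ tendsto_const], auto)
  then show ?thesis by (simp add: LIM_zero_iff T_def m_def)
qed

text \<open>A Lebesgue integrable \<open>f\<close> agrees almost everywhere with a Borel function,
  to which the translation argument applies. The oscillating factor is Borel from the start.\<close>

lemma oscillation_limit:
  fixes f p :: "real^'n \<Rightarrow> real"
  assumes L: "L > 0" and eps: "\<And>n. \<epsilon> n > 0" "\<epsilon> \<longlonglongrightarrow> (0::real)"
    and f: "integrable lebesgue f"
    and p_meas [measurable]: "p \<in> borel_measurable borel" and p: "\<And>y. \<bar>p y\<bar> \<le> C"
    and per: "\<And>i y. p (y + axis i L) = p y"
  shows "(\<lambda>n. \<integral>x. f x * p ((1 / \<epsilon> n) *\<^sub>R x) \<partial>lebesgue)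
    \<longlonglongrightarrow> (\<integral>x. f x \<partial>lebesgue) * (\<integral>y. p y \<partial>unif_cell L)"
proof -
  have fm [measurable]: "f \<in> borel_measurable lebesgue" using f by (rule borel_measurable_integrable)
  obtain g where gm: "g \<in> borel_measurable lborel" and ae: "AE x in lborel. f x = g x"
    using completion_ex_borel_measurable_real[OF fm] by blast
  have [measurable]: "g \<in> borel_measurable borel" using gm by simp
  have ae': "AE x in lebesgue. f x = g x" using ae by (simp add: AE_completion_iff)
  have eq: "(\<integral>x. f x * q x \<partial>lebesgue) = (\<integral>x. g x * q x \<partial>lborel)"
    if [measurable]: "q \<in> borel_measurable borel" for q :: "real^'n \<Rightarrow> real"
  proof -
    have gq: "(\<lambda>x. g x * q x) \<in> borel_measurable lborel" by measurable
    have [measurable]: "q \<in> borel_measurable lebesgue" "g \<in> borel_measurable lebesgue"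
      by (auto intro: measurable_completion)
    have "(\<integral>x. f x * q x \<partial>lebesgue) = (\<integral>x. g x * q x \<partial>lebesgue)"
      by (rule integral_cong_AE) (use ae' in auto)
    also have "\<dots> = (\<integral>x. g x * q x \<partial>lborel)"
      by (rule integral_completion[OF gq])
    finally show ?thesis .
  qed
  have "integrable lebesgue g"
    by (rule integrable_cong_AE_imp[OF f _ ae']) (auto intro: measurable_completion)
  then have "integrable lborel g" using integrable_completion[OF gm] by simp
  from oscillation_limit_lborel[OF L eps this p_meas p per]
  show ?thesis using eq[of "\<lambda>x. 1"] by (simp add: eq)
qed

section \<open>Grid approximation of periodic functions\<close>

text \<open>The lower corner of the grid cube that contains the representative of \<open>y\<close>
  in the period cell; for \<open>L > 0\<close> this depends on \<open>y\<close> only modulo the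
  period. Counting subdivisions by \<open>Suc m\<close> keeps their number positive.\<close>

definition grid_round :: "real \<Rightarrow> nat \<Rightarrow> real^'n \<Rightarrow> real^'n" where
  "grid_round L m y = (\<chi> i. L / real (Suc m) * of_int \<lfloor>real (Suc m) * frac (y $ i / L)\<rfloor>)"

lemma grid_round_periodic:
  assumes "L > 0"
  shows "grid_round L m (y + axis i L) = grid_round L m y"
proof -
  have "frac ((y + axis i L) $ j / L) = frac (y $ j / L)" for j
    using assms by (simp add: axis_def add_divide_distrib frac_1_eq)
  then show ?thesis by (simp add: grid_round_def)
qed

lemma finite_range_grid_round: "finite (range (grid_round L m :: real^'n \<Rightarrow> real^'n))"
proof -
  define S where "S = (\<lambda>k. L / real (Suc m) * of_int k) ` {0..int m}"
  have "finite S" by (simp add: S_def)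
  have "grid_round L m y $ i \<in> S" for y :: "real^'n" and i
  proof -
    let ?k = "\<lfloor>real (Suc m) * frac (y $ i / L)\<rfloor>"
    have "real (Suc m) * frac (y $ i / L) < real (Suc m) * 1"
      by (rule mult_strict_left_mono[OF frac_lt_1]) simp
    then have "0 \<le> ?k" "?k < int (Suc m)" by (simp_all add: floor_less_iff)
    then have "?k \<in> {0..int m}" by simp
    then show ?thesis unfolding S_def grid_round_def vec_lambda_beta by (rule imageI)
  qed
  then have "range (grid_round L m :: real^'n \<Rightarrow> real^'n) \<subseteq> vec_lambda ` (\<Pi>\<^sub>E i\<in>UNIV. S)"
    by (auto intro!: image_eqI[of _ vec_lambda "vec_nth _"])
  moreover have "finite (\<Pi>\<^sub>E i\<in>(UNIV::'n set). S)" using \<open>finite S\<close> by (intro finite_PiE) auto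
  ultimately show ?thesis using finite_surj by blast
qed

text \<open>Rounding down moves each coordinate by at most one grid side, and the Euclidean norm is
  at most the sum of the coordinates, whence the factor \<open>CARD('n)\<close>. The comparison is
  with \<open>period_rem L y\<close> because the rounding already reduces modulo the period.\<close>

lemma grid_round_close:
  fixes y :: "real^'n"
  assumes "L > 0"
  shows "dist (grid_round L m y) (period_rem L y) \<le> real CARD('n) * (L / real (Suc m))"
proof -
  have "\<bar>(grid_round L m y - period_rem L y) $ i\<bar> \<le> L / real (Suc m)" for i
  proof -
    define t where "t = real (Suc m) * frac (y $ i / L)"
    have "(grid_round L m y - period_rem L y) $ i = L / real (Suc m) * (of_int \<lfloor>t\<rfloor> - t)"
      by (simp add: grid_round_def period_rem_def t_def field_simps)
    also have "\<bar>\<dots>\<bar> = L / real (Suc m) * \<bar>of_int \<lfloor>t\<rfloor> - t\<bar>"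
      using assms by (simp add: abs_mult)
    also have "\<dots> \<le> L / real (Suc m) * 1"
      using assms by (intro mult_left_mono) (auto, linarith)
    finally show ?thesis by simp
  qed
  then have "(\<Sum>i\<in>UNIV. \<bar>(grid_round L m y - period_rem L y) $ i\<bar>) \<le> real CARD('n) * (L / real (Suc m))"
    using sum_bounded_above[of UNIV "\<lambda>i. \<bar>(grid_round L m y - period_rem L y) $ i\<bar>" "L / real (Suc m)"]
    by blast
  then show ?thesis using norm_le_l1_cart[of "grid_round L m y - period_rem L y"] by (simp add: dist_norm)
qed

lemma grid_round_in_cell:
  assumes "L > 0"
  shows "grid_round L m y \<in> cell L"
proof -
  have "0 \<le> grid_round L m y $ i \<and> grid_round L m y $ i \<le> L" for i
  proof -
    define t where "t = real (Suc m) * frac (y $ i / L)"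
    have "0 \<le> t" by (simp add: t_def)
    have "t \<le> real (Suc m)" using frac_lt_1[of "y $ i / L"] by (simp add: t_def mult_left_le less_imp_le)
    then have "L / real (Suc m) * of_int \<lfloor>t\<rfloor> \<le> L / real (Suc m) * real (Suc m)"
      using assms by (intro mult_left_mono) (auto intro: order_trans[OF of_int_floor_le])
    moreover have "grid_round L m y $ i = L / real (Suc m) * of_int \<lfloor>t\<rfloor>"
      by (simp only: grid_round_def vec_lambda_beta t_def)
    ultimately show ?thesis using \<open>0 \<le> t\<close> assms by simp
  qed
  then show ?thesis by (simp add: cell_def mem_box_cart)
qed

text \<open>The level and the corner form one index, so that the indicators of all levels make up a
  single countable family.\<close>

definition grid_ind :: "real \<Rightarrow> nat \<times> (real^'n) \<Rightarrow> real^'n \<Rightarrow> real" where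
  "grid_ind L k y = (if grid_round L (fst k) y = snd k then 1 else 0)"

lemma grid_ind_measurable [measurable]: "grid_ind L k \<in> borel_measurable borel"
proof -
  have [measurable]: "(\<lambda>y :: real^'n. y $ i) \<in> borel_measurable borel" for i
    by (intro borel_measurable_continuous_onI continuous_intros)
  have "{y. grid_round L (fst k) y = snd k}
    = (\<Inter>i. {y \<in> space borel. L / real (Suc (fst k)) * of_int \<lfloor>real (Suc (fst k)) * frac (y $ i / L)\<rfloor> = snd k $ i})"
    by (auto simp: grid_round_def vec_eq_iff)
  also have "\<dots> \<in> sets borel"
    unfolding frac_def by (intro sets.finite_INT) auto
  finally show ?thesis
    unfolding grid_ind_def by (intro measurable_If) (auto simp: pred_def)
qed

lemma grid_ind_bound: "\<bar>grid_ind L k y\<bar> \<le> 1"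
  by (simp add: grid_ind_def)

lemma grid_ind_periodic: "L > 0 \<Longrightarrow> grid_ind L k (y + axis i L) = grid_ind L k y"
  by (simp add: grid_ind_def grid_round_periodic)

text \<open>Exactly one indicator of the level is nonzero at \<open>y\<close>. With \<open>q\<close>
  taken as \<open>\<psi> x\<close>, this turns the rounded test function into a finite sum of
  coefficients in \<open>x\<close> times periodic factors in \<open>y\<close>.\<close>

lemma sum_grid_ind:
  fixes q :: "real^'n \<Rightarrow> real"
  shows "(\<Sum>c\<in>range (grid_round L m). q c * grid_ind L (m, c) y) = q (grid_round L m y)"
proof -
  have "(\<Sum>c\<in>range (grid_round L m). q c * grid_ind L (m, c) y)
    = (\<Sum>c\<in>range (grid_round L m). if grid_round L m y = c then q c else 0)"
    by (intro sum.cong) (auto simp: grid_ind_def)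
  then show ?thesis by (simp add: finite_range_grid_round)
qed

text \<open>The supremum is over the whole space, hence it also bounds the rounding error at
  \<open>y = x / \<epsilon> n\<close> for every \<open>n\<close>.\<close>

definition grid_osc :: "real \<Rightarrow> nat \<Rightarrow> ((real^'n) \<Rightarrow>\<^sub>C real) \<Rightarrow> real" where
  "grid_osc L m f = (SUP y. \<bar>apply_bcontfun f y - apply_bcontfun f (grid_round L m y)\<bar>)"

lemma abs_bcontfun_le_norm: "\<bar>apply_bcontfun f y\<bar> \<le> norm f" for f :: "'a::topological_space \<Rightarrow>\<^sub>C real"
  using norm_bounded[of f y] by simp

lemma grid_diff_le_norm: "\<bar>apply_bcontfun f y - apply_bcontfun f (grid_round L m y)\<bar> \<le> 2 * norm f"
  using abs_bcontfun_le_norm[of f y] abs_bcontfun_le_norm[of f "grid_round L m y"] by linarith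

lemma grid_diff_le_osc: "\<bar>apply_bcontfun f y - apply_bcontfun f (grid_round L m y)\<bar> \<le> grid_osc L m f"
  unfolding grid_osc_def by (rule cSUP_upper) (auto intro!: bdd_aboveI2 grid_diff_le_norm)

lemma grid_osc_nonneg: "0 \<le> grid_osc L m f"
  using grid_diff_le_osc[of f 0 L m] by linarith

lemma grid_osc_le_norm: "grid_osc L m f \<le> 2 * norm f"
  unfolding grid_osc_def by (rule cSUP_least) (auto intro!: grid_diff_le_norm)

lemma grid_osc_lipschitz: "grid_osc L m f \<le> grid_osc L m g + 2 * dist f g"
  unfolding grid_osc_def[of L m f]
proof (rule cSUP_least)
  fix y
  show "\<bar>apply_bcontfun f y - apply_bcontfun f (grid_round L m y)\<bar> \<le> grid_osc L m g + 2 * dist f g"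
    using grid_diff_le_osc[of g y L m] dist_bounded[of f y g] dist_bounded[of f "grid_round L m y" g]
    unfolding dist_real_def by linarith
qed simp

text \<open>Lipschitz dependence on the function in the supremum norm bypasses the uncountable
  supremum: composed with a measurable \<open>\<psi>\<close>, the oscillation is measurable in
  \<open>x\<close>.\<close>

lemma grid_osc_measurable: "(grid_osc L m :: ((real^'n) \<Rightarrow>\<^sub>C real) \<Rightarrow> real) \<in> borel_measurable borel"
proof (rule borel_measurable_continuous_onI, rule lipschitz_on_continuous_on)
  show "2-lipschitz_on UNIV (grid_osc L m :: ((real^'n) \<Rightarrow>\<^sub>C real) \<Rightarrow> real)"
  proof (rule lipschitz_onI)
    fix f g :: "(real^'n) \<Rightarrow>\<^sub>C real"
    show "dist (grid_osc L m f) (grid_osc L m g) \<le> 2 * dist f g"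
      using grid_osc_lipschitz[of L m f g] grid_osc_lipschitz[of L m g f]
      unfolding dist_real_def by (simp add: dist_commute abs_le_iff)
  qed simp
qed

text \<open>Periodicity moves \<open>y\<close> to its representative in the compact cell, where
  \<open>f\<close> is uniformly continuous; the grid corner lies in the same cell at a distance
  controlled by the mesh.\<close>

lemma grid_osc_tendsto_zero:
  assumes L: "L > 0" and f: "f \<in> C0per L"
  shows "(\<lambda>m. grid_osc L m f) \<longlonglongrightarrow> 0"
proof (rule LIMSEQ_I)
  fix e :: real assume "e > 0"
  have "uniformly_continuous_on (cell L) (apply_bcontfun f)"
    by (rule compact_uniformly_continuous) (auto simp: cell_def)
  then obtain d where d: "d > 0"
    and uc: "\<And>y z. y \<in> cell L \<Longrightarrow> z \<in> cell L \<Longrightarrow> dist z y < d \<Longrightarrow> dist (apply_bcontfun f z) (apply_bcontfun f y) < e / 2"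
    unfolding uniformly_continuous_on_def using \<open>e > 0\<close> by (meson half_gt_zero)
  have "(\<lambda>m. real CARD('a) * (L / real (Suc m))) \<longlonglongrightarrow> 0"
    by (intro tendsto_mult_right_zero LIMSEQ_Suc[OF lim_const_over_n])
  from LIMSEQ_D[OF this d] obtain m0 where m0: "\<And>m. m \<ge> m0 \<Longrightarrow> real CARD('a) * (L / real (Suc m)) < d"
    using L by auto
  have "grid_osc L m f \<le> e / 2" if "m \<ge> m0" for m
    unfolding grid_osc_def
  proof (rule cSUP_least)
    fix y
    have "apply_bcontfun f (period_rem L y) = apply_bcontfun f y"
      using f by (intro periodic_period_rem[OF L]) (simp add: C0per_def)
    then show "\<bar>apply_bcontfun f y - apply_bcontfun f (grid_round L m y)\<bar> \<le> e / 2"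
      using uc[OF period_rem_in_cell[OF L] grid_round_in_cell[OF L] le_less_trans[OF grid_round_close[OF L] m0[OF that]], of y]
      unfolding dist_real_def by linarith
  qed simp
  then show "\<exists>m0. \<forall>m\<ge>m0. norm (grid_osc L m f - 0) < e"
    using \<open>e > 0\<close> grid_osc_nonneg[of L _ f] by (intro exI[of _ m0]) (fastforce intro: le_less_trans)
qed

section \<open>Two-scale compactness\<close>

lemma sigma_finite_lebesgue: "sigma_finite_measure (lebesgue :: 'a::euclidean_space measure)"
proof
  obtain A :: "'a set set" where A: "countable A" "A \<subseteq> sets lborel" "\<Union> A = space lborel" "\<forall>a\<in>A. emeasure lborel a \<noteq> \<infinity>"
    using lborel.sigma_finite_countable by blast
  show "\<exists>A::'a set set. countable A \<and> A \<subseteq> sets lebesgue \<and> \<Union> A = space lebesgue \<and> (\<forall>a\<in>A. emeasure lebesgue a \<noteq> \<infinity>)"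
    using A by (intro exI[of _ A]) auto
qed

lemma L2_pair_fst:
  assumes M: "sigma_finite_measure M" and N: "finite_measure N" "emeasure N (space N) = 1"
    and k: "k \<in> L2 M"
  shows "(\<lambda>z. k (fst z)) \<in> L2 (M \<Otimes>\<^sub>M N)"
    and "(\<integral>z. (k (fst z))\<^sup>2 \<partial>(M \<Otimes>\<^sub>M N)) = (\<integral>x. (k x)\<^sup>2 \<partial>M)"
  using integrable_pair_fst[OF M N L2_square[OF k]] L2_measurable[OF k] by (auto simp: L2_def)

text \<open>The scalar factor \<open>w\<close>, later \<open>sqrt \<rho>\<close>, is kept apart from
  \<open>\<psi>\<close>, so that measurability into the Banach space is asked of
  \<open>\<psi>\<close> itself and integrability only of \<open>w x * norm (\<psi> x)\<close>. The
  membership of the test function in \<open>L2\<close> of the product is part of the conclusion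
  because Fubini needs it afterwards.\<close>

lemma L2_two_scale_compactness:
  fixes f :: "nat \<Rightarrow> real^'n \<Rightarrow> real" and \<epsilon> :: "nat \<Rightarrow> real"
  assumes L: "L > 0" and eps: "\<And>n. \<epsilon> n > 0" "\<epsilon> \<longlonglongrightarrow> 0"
    and f: "\<And>n. f n \<in> L2 lebesgue" and M: "0 \<le> M" "\<And>n. (\<integral>x. (f n x)\<^sup>2 \<partial>lebesgue) \<le> M\<^sup>2"
  obtains r :: "nat \<Rightarrow> nat" and f0 where "strict_mono r" "f0 \<in> L2 (lebesgue \<Otimes>\<^sub>M unif_cell L)"
    and "\<And>w \<psi>. w \<in> borel_measurable lebesgue \<Longrightarrow> \<psi> \<in> lebesgue \<rightarrow>\<^sub>M borel \<Longrightarrow> (\<And>x. \<psi> x \<in> C0per L) \<Longrightarrow>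
      (\<lambda>x. w x * norm (\<psi> x)) \<in> L2 lebesgue \<Longrightarrow>
      (\<lambda>z. w (fst z) * apply_bcontfun (\<psi> (fst z)) (snd z)) \<in> L2 (lebesgue \<Otimes>\<^sub>M unif_cell L) \<and>
      (\<lambda>n. \<integral>x. f (r n) x * (w x * apply_bcontfun (\<psi> x) ((1 / \<epsilon> (r n)) *\<^sub>R x)) \<partial>lebesgue)
        \<longlonglongrightarrow> (\<integral>z. f0 z * (w (fst z) * apply_bcontfun (\<psi> (fst z)) (snd z)) \<partial>(lebesgue \<Otimes>\<^sub>M unif_cell L))"
proof -
  let ?U = "unif_cell L :: (real^'n) measure"
  let ?X = "lebesgue :: (real^'n) measure"
  let ?Q = "?X \<Otimes>\<^sub>M ?U"
  note finU = finite_measure_unif_cell[OF L, where 'n='n]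
  have probU: "emeasure ?U (space ?U) = 1" using emeasure_unif_cell[OF L] by simp
  note sfX = sigma_finite_lebesgue[where 'a="real^'n"]
  interpret U: finite_measure ?U by (rule finU)
  interpret X: sigma_finite_measure ?X by (rule sfX)
  interpret Q: pair_sigma_finite ?X ?U ..
  have [measurable]: "grid_ind L k \<in> borel_measurable lebesgue" for k :: "nat \<times> (real^'n)"
    by (auto intro: measurable_completion)
  have sc [measurable]: "(\<lambda>x. c *\<^sub>R x) \<in> ?X \<rightarrow>\<^sub>M borel" for c
    by (auto intro: measurable_completion)
  have grid_sc [measurable]: "(\<lambda>x. grid_ind L k (c *\<^sub>R x)) \<in> borel_measurable ?X" for k c
    by measurable
  have grid_mult: "(\<lambda>x. a x * grid_ind L k (c *\<^sub>R x)) \<in> L2 ?X"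
    "(\<integral>x. (a x * grid_ind L k (c *\<^sub>R x))\<^sup>2 \<partial>?X) \<le> (\<integral>x. (a x)\<^sup>2 \<partial>?X)" if a: "a \<in> L2 ?X" for a k c
  proof -
    have [measurable]: "a \<in> borel_measurable ?X" using a by (rule L2_measurable)
    have "\<bar>a x * grid_ind L k (c *\<^sub>R x)\<bar> \<le> \<bar>a x\<bar>" for x
      by (simp add: abs_mult mult_left_le grid_ind_bound)
    then show "(\<lambda>x. a x * grid_ind L k (c *\<^sub>R x)) \<in> L2 ?X"
      "(\<integral>x. (a x * grid_ind L k (c *\<^sub>R x))\<^sup>2 \<partial>?X) \<le> (\<integral>x. (a x)\<^sup>2 \<partial>?X)"
      using L2_dominated[OF a, of "\<lambda>x. a x * grid_ind L k (c *\<^sub>R x)"] by auto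
  qed
  define K where "K = (SIGMA m:UNIV. range (grid_round L m :: real^'n \<Rightarrow> real^'n))"
  have "countable K"
    unfolding K_def by (intro countable_SIGMA) (auto intro: countable_finite finite_range_grid_round)
  define H where "H k n x = f n x * grid_ind L k ((1 / \<epsilon> n) *\<^sub>R x)" for k n x
  have HL: "H k n \<in> L2 ?X" "(\<integral>x. (H k n x)\<^sup>2 \<partial>?X) \<le> M\<^sup>2" for k n
    using grid_mult[OF f[of n], of k "1 / \<epsilon> n"] M(2)[of n] by (simp_all add: H_def[abs_def])
  obtain r :: "nat \<Rightarrow> nat" where r: "strict_mono r"
    and Hconv: "\<And>k a. k \<in> K \<Longrightarrow> a \<in> L2 ?X \<Longrightarrow> convergent (\<lambda>n. \<integral>x. H k (r n) x * a x \<partial>?X)"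
  proof (rule L2_weak_compactness[OF \<open>countable K\<close> HL M(1)])
    fix r :: "nat \<Rightarrow> nat"
    assume "strict_mono r" "\<And>k a. k \<in> K \<Longrightarrow> a \<in> L2 ?X \<Longrightarrow> convergent (\<lambda>n. \<integral>x. H k (r n) x * a x \<partial>?X)"
    then show thesis by (rule that)
  qed
  define e where "e n = \<epsilon> (r n)" for n
  have e: "\<And>n. e n > 0" "e \<longlonglongrightarrow> 0"
    using eps(1) LIMSEQ_subseq_LIMSEQ[OF eps(2) r] by (auto simp: e_def[abs_def] o_def)
  \<comment> \<open>The trace of \<open>v\<close> along the graph \<open>y = x / e n\<close>. It
    depends on the values of \<open>v\<close> on a null set, so \<open>v\<close> has to be an actual
    function and not a class.\<close>
  define ev where "ev n v x = v (x, (1 / e n) *\<^sub>R x)" for n x and v :: "(real^'n) \<times> (real^'n) \<Rightarrow> real"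
  define G where "G = {\<lambda>z. a (fst z) * grid_ind L k (snd z) |a k. a \<in> L2 ?X \<and> k \<in> K}"
  have G_L2: "G \<subseteq> L2 ?Q"
  proof
    fix v assume "v \<in> G"
    then obtain a k where v: "v = (\<lambda>z. a (fst z) * grid_ind L k (snd z))" and a: "a \<in> L2 ?X"
      by (auto simp: G_def)
    have [measurable]: "a \<in> borel_measurable ?X" using a by (rule L2_measurable)
    show "v \<in> L2 ?Q"
    proof (rule L2_dominated(1)[OF L2_pair_fst(1)[OF sfX finU probU a]])
      show "v \<in> borel_measurable ?Q" unfolding v by measurable
      show "AE z in ?Q. \<bar>v z\<bar> \<le> \<bar>a (fst z)\<bar>"
        by (simp add: v abs_mult mult_left_le grid_ind_bound)
    qed
  qed
  note span_L2 = fspan_L2[OF G_L2]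
  have ev_step: "ev n (\<lambda>z. c * b z + w z) = (\<lambda>x. c * ev n b x + ev n w x)" for n c b w
    by (rule ext) (simp add: ev_def)
  have ev_L2: "ev n v \<in> L2 ?X" if "v \<in> fspan G" for n v
    using that
  proof induction
    case zero
    then show ?case by (simp add: ev_def[abs_def] L2_zero)
  next
    case (step b w c)
    have "ev n b \<in> L2 ?X" using step.hyps(1) grid_mult(1) by (auto simp: G_def ev_def[abs_def])
    then show ?case unfolding ev_step using step.IH by (rule L2_axpy)
  qed
  have lim_f: "convergent (\<lambda>n. \<integral>x. f (r n) x * ev n v x \<partial>?X)" if "v \<in> fspan G" for v
    using that
  proof induction
    case zero
    then show ?case by (simp add: ev_def convergent_const)
  next
    case (step b w c)
    then obtain a k where b: "b = (\<lambda>z. a (fst z) * grid_ind L k (snd z))" and a: "a \<in> L2 ?X" and k: "k \<in> K"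
      by (auto simp: G_def)
    have "(\<lambda>n. \<integral>x. f (r n) x * ev n b x \<partial>?X) = (\<lambda>n. \<integral>x. H k (r n) x * a x \<partial>?X)"
      by (simp add: b ev_def H_def e_def mult_ac)
    then have "convergent (\<lambda>n. c * (\<integral>x. f (r n) x * ev n b x \<partial>?X) + (\<integral>x. f (r n) x * ev n w x \<partial>?X))"
      using Hconv[OF k a] by (intro convergent_add convergent_mult convergent_const step.IH) simp
    also have "(\<lambda>n. c * (\<integral>x. f (r n) x * ev n b x \<partial>?X) + (\<integral>x. f (r n) x * ev n w x \<partial>?X))
      = (\<lambda>n. \<integral>x. f (r n) x * ev n (\<lambda>z. c * b z + w z) x \<partial>?X)"
    proof
      fix n
      show "c * (\<integral>x. f (r n) x * ev n b x \<partial>?X) + (\<integral>x. f (r n) x * ev n w x \<partial>?X)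
        = (\<integral>x. f (r n) x * ev n (\<lambda>z. c * b z + w z) x \<partial>?X)"
        using L2_integrable_mult[OF f ev_L2[OF fspan_base[OF step.hyps(1)]], of "r n" n]
          L2_integrable_mult[OF f ev_L2[OF step.hyps(2)], of "r n" n]
        by (simp add: ev_step distrib_left mult.left_commute)
    qed
    finally show ?case .
  qed
  have lim_gen: "(\<lambda>n. \<integral>x. ev n v x * ev n w x \<partial>?X) \<longlonglongrightarrow> (\<integral>z. v z * w z \<partial>?Q)" if vG: "v \<in> G" and wG: "w \<in> G" for v w
  proof -
    obtain a k where v: "v = (\<lambda>z. a (fst z) * grid_ind L k (snd z))" and a: "a \<in> L2 ?X"
      using vG by (auto simp: G_def)
    obtain b l where w: "w = (\<lambda>z. b (fst z) * grid_ind L l (snd z))" and b: "b \<in> L2 ?X"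
      using wG by (auto simp: G_def)
    \<comment> \<open>The product of two grid indicators is again bounded, Borel and periodic, so
      the mean value limit applies with the integrable factor \<open>a x * b x\<close>; Fubini reads
      the result as an inner product in \<open>?Q\<close>.\<close>
    define p where "p y = grid_ind L k y * grid_ind L l y" for y
    have [measurable]: "p \<in> borel_measurable borel" unfolding p_def by measurable
    have p1: "\<bar>p y\<bar> \<le> 1" for y by (simp add: p_def grid_ind_def)
    have pp: "p (y + axis i L) = p y" for y i by (simp add: p_def grid_ind_periodic[OF L])
    have "(\<lambda>n. \<integral>x. (a x * b x) * p ((1 / e n) *\<^sub>R x) \<partial>?X)
        \<longlonglongrightarrow> (\<integral>x. a x * b x \<partial>?X) * (\<integral>y. p y \<partial>?U)"
      by (rule oscillation_limit[OF L e L2_integrable_mult[OF a b] _ p1 pp]) measurable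
    also have "(\<integral>x. a x * b x \<partial>?X) * (\<integral>y. p y \<partial>?U) = (\<integral>z. v z * w z \<partial>?Q)"
    proof -
      have "(\<integral>z. v z * w z \<partial>?Q) = (\<integral>x. \<integral>y. v (x, y) * w (x, y) \<partial>?U \<partial>?X)"
        using Q.integral_fst'[OF L2_integrable_mult[OF subsetD[OF G_L2 vG] subsetD[OF G_L2 wG]]] by simp
      also have "\<dots> = (\<integral>x. \<integral>y. (a x * b x) * p y \<partial>?U \<partial>?X)"
        by (simp add: v w p_def mult_ac)
      finally show ?thesis by simp
    qed
    finally show ?thesis by (simp add: v w ev_def p_def mult_ac)
  qed
  \<comment> \<open>The limit of inner products is extended from generators to the span one argument
    at a time. In the diagonal case, the norms of the traces converge to the norm in the
    product.\<close>
  have lim_gen_span: "(\<lambda>n. \<integral>x. ev n v x * ev n w x \<partial>?X) \<longlonglongrightarrow> (\<integral>z. v z * w z \<partial>?Q)"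
    if vG: "v \<in> G" and w: "w \<in> fspan G" for v w
    using w
  proof induction
    case zero
    then show ?case by (simp add: ev_def)
  next
    case (step b w c)
    note vS = fspan_base[OF vG] and bS = fspan_base[OF step.hyps(1)]
    have "(\<lambda>n. c * (\<integral>x. ev n v x * ev n b x \<partial>?X) + (\<integral>x. ev n v x * ev n w x \<partial>?X))
        \<longlonglongrightarrow> c * (\<integral>z. v z * b z \<partial>?Q) + (\<integral>z. v z * w z \<partial>?Q)"
      by (intro tendsto_intros lim_gen vG step)
    moreover have "c * (\<integral>z. v z * b z \<partial>?Q) + (\<integral>z. v z * w z \<partial>?Q) = (\<integral>z. v z * (c * b z + w z) \<partial>?Q)"
      using L2_integrable_mult[OF span_L2[OF vS] span_L2[OF bS]] L2_integrable_mult[OF span_L2[OF vS] span_L2[OF step.hyps(2)]]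
      by (simp add: distrib_left mult.left_commute)
    moreover have "c * (\<integral>x. ev n v x * ev n b x \<partial>?X) + (\<integral>x. ev n v x * ev n w x \<partial>?X)
        = (\<integral>x. ev n v x * ev n (\<lambda>z. c * b z + w z) x \<partial>?X)" for n
      using L2_integrable_mult[OF ev_L2[OF vS] ev_L2[OF bS], of n n] L2_integrable_mult[OF ev_L2[OF vS] ev_L2[OF step.hyps(2)], of n n]
      by (simp add: ev_step distrib_left mult.left_commute)
    ultimately show ?case by simp
  qed
  have lim_span: "(\<lambda>n. \<integral>x. ev n v x * ev n w x \<partial>?X) \<longlonglongrightarrow> (\<integral>z. v z * w z \<partial>?Q)"
    if v: "v \<in> fspan G" and w: "w \<in> fspan G" for v w
    using v
  proof induction
    case zero
    then show ?case by (simp add: ev_def)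
  next
    case (step b v c)
    note bS = fspan_base[OF step.hyps(1)]
    have "(\<lambda>n. c * (\<integral>x. ev n b x * ev n w x \<partial>?X) + (\<integral>x. ev n v x * ev n w x \<partial>?X))
        \<longlonglongrightarrow> c * (\<integral>z. b z * w z \<partial>?Q) + (\<integral>z. v z * w z \<partial>?Q)"
      by (intro tendsto_intros lim_gen_span w step)
    moreover have "c * (\<integral>z. b z * w z \<partial>?Q) + (\<integral>z. v z * w z \<partial>?Q) = (\<integral>z. (c * b z + v z) * w z \<partial>?Q)"
      using L2_integrable_mult[OF span_L2[OF bS] span_L2[OF w]] L2_integrable_mult[OF span_L2[OF step.hyps(2)] span_L2[OF w]]
      by (simp add: distrib_right mult.assoc)
    moreover have "c * (\<integral>x. ev n b x * ev n w x \<partial>?X) + (\<integral>x. ev n v x * ev n w x \<partial>?X)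
        = (\<integral>x. ev n (\<lambda>z. c * b z + v z) x * ev n w x \<partial>?X)" for n
      using L2_integrable_mult[OF ev_L2[OF bS] ev_L2[OF w], of n n] L2_integrable_mult[OF ev_L2[OF step.hyps(2)] ev_L2[OF w], of n n]
      by (simp add: ev_step distrib_right mult.assoc)
    ultimately show ?case by simp
  qed
  \<comment> \<open>Defining \<open>F\<close> on functions, and not on their representations as
    sums, makes it well defined at once; linearity is inherited from the integrals.\<close>
  define F where "F v = lim (\<lambda>n. \<integral>x. f (r n) x * ev n v x \<partial>?X)" for v
  have F: "(\<lambda>n. \<integral>x. f (r n) x * ev n v x \<partial>?X) \<longlonglongrightarrow> F v" if "v \<in> fspan G" for v
    using lim_f[OF that] by (simp add: F_def convergent_LIMSEQ_iff)
  have F_lin: "F (\<lambda>z. c * v z + w z) = c * F v + F w" if v: "v \<in> fspan G" and w: "w \<in> fspan G" for v w c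
  proof -
    have "(\<integral>x. f (r n) x * ev n (\<lambda>z. c * v z + w z) x \<partial>?X)
        = c * (\<integral>x. f (r n) x * ev n v x \<partial>?X) + (\<integral>x. f (r n) x * ev n w x \<partial>?X)" for n
      using L2_integrable_mult[OF f ev_L2[OF v], of "r n" n] L2_integrable_mult[OF f ev_L2[OF w], of "r n" n]
      by (simp add: ev_step distrib_left mult.left_commute)
    then have "(\<lambda>n. \<integral>x. f (r n) x * ev n (\<lambda>z. c * v z + w z) x \<partial>?X) \<longlonglongrightarrow> c * F v + F w"
      by (simp, intro tendsto_intros F v w)
    then show ?thesis using F[OF fspan_axpy[OF v w]] LIMSEQ_unique by blast
  qed
  have F_bnd: "\<bar>F v\<bar> \<le> M * sqrt (\<integral>z. (v z)\<^sup>2 \<partial>?Q)" if v: "v \<in> fspan G" for v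
  proof (rule LIMSEQ_le)
    show "(\<lambda>n. \<bar>\<integral>x. f (r n) x * ev n v x \<partial>?X\<bar>) \<longlonglongrightarrow> \<bar>F v\<bar>" by (intro tendsto_intros F v)
    show "(\<lambda>n. M * sqrt (\<integral>x. ev n v x * ev n v x \<partial>?X)) \<longlonglongrightarrow> M * sqrt (\<integral>z. (v z)\<^sup>2 \<partial>?Q)"
      using lim_span[OF v v] by (intro tendsto_intros) (simp add: power2_eq_square)
    have "\<bar>\<integral>x. f (r n) x * ev n v x \<partial>?X\<bar> \<le> M * sqrt (\<integral>x. ev n v x * ev n v x \<partial>?X)" for n
      by (rule L2_Cauchy_Schwarz_le[OF f ev_L2[OF v] M(2)]) (use M(1) in \<open>auto simp: power2_eq_square[symmetric]\<close>)
    then show "\<exists>N. \<forall>n\<ge>N. \<bar>\<integral>x. f (r n) x * ev n v x \<partial>?X\<bar> \<le> M * sqrt (\<integral>x. ev n v x * ev n v x \<partial>?X)"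
      by blast
  qed
  obtain f0 where f0: "f0 \<in> L2 ?Q" and F0: "\<And>v. v \<in> fspan G \<Longrightarrow> F v = (\<integral>z. f0 z * v z \<partial>?Q)"
  proof (rule L2_Riesz[OF G_L2 F_lin F_bnd])
    fix g and u :: "nat \<Rightarrow> (real^'n) \<times> (real^'n) \<Rightarrow> real"
    assume "g \<in> L2 ?Q" "\<And>v. v \<in> fspan G \<Longrightarrow> F v = (\<integral>z. g z * v z \<partial>?Q)"
    then show thesis by (rule that)
  qed
  show ?thesis
  proof (rule that[OF r f0])
    fix w :: "real^'n \<Rightarrow> real" and \<psi> :: "real^'n \<Rightarrow> ((real^'n) \<Rightarrow>\<^sub>C real)"
    assume wm [measurable]: "w \<in> borel_measurable ?X" and \<psi>m [measurable]: "\<psi> \<in> ?X \<rightarrow>\<^sub>M borel"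
      and \<psi>: "\<And>x. \<psi> x \<in> C0per L" and dom: "(\<lambda>x. w x * norm (\<psi> x)) \<in> L2 ?X"
    have app_c: "(\<lambda>h :: (real^'n) \<Rightarrow>\<^sub>C real. apply_bcontfun h c) \<in> borel_measurable borel" for c :: "real^'n"
    proof (rule borel_measurable_continuous_onI, rule lipschitz_on_continuous_on)
      show "1-lipschitz_on UNIV (\<lambda>h :: (real^'n) \<Rightarrow>\<^sub>C real. apply_bcontfun h c)"
        by (rule lipschitz_onI) (simp_all add: dist_bounded)
    qed
    have [measurable]: "(\<lambda>x. apply_bcontfun (\<psi> x) c) \<in> borel_measurable ?X" for c
      by (rule measurable_compose[OF \<psi>m app_c])
    define g where "g z = w (fst z) * apply_bcontfun (\<psi> (fst z)) (snd z)" for z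
    define gm where "gm m z = w (fst z) * apply_bcontfun (\<psi> (fst z)) (grid_round L m (snd z))" for m z
    \<comment> \<open>A common envelope, depending on \<open>x\<close> only, for the rounding error
      in the product and along every trace.\<close>
    define k where "k m x = w x * grid_osc L m (\<psi> x)" for m x
    have gm_span: "gm m \<in> fspan G" for m
    proof -
      let ?b = "\<lambda>c z. (w (fst z) * apply_bcontfun (\<psi> (fst z)) c) * grid_ind L (m, c) (snd z)"
      have "(\<lambda>z. \<Sum>c\<in>range (grid_round L m). ?b c z) \<in> fspan G"
      proof (rule fspan_sum[OF finite_range_grid_round])
        fix c :: "real^'n" assume c: "c \<in> range (grid_round L m)"
        have "(\<lambda>x. w x * apply_bcontfun (\<psi> x) c) \<in> L2 ?X"
          by (rule L2_dominated(1)[OF dom])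
            (auto simp: abs_mult intro!: AE_I2 mult_left_mono abs_bcontfun_le_norm)
        with c show "?b c \<in> G"
          unfolding G_def K_def mem_Collect_eq
          by (intro exI[of _ "\<lambda>x. w x * apply_bcontfun (\<psi> x) c"] exI[of _ "(m, c)"]) simp
      qed
      also have "(\<lambda>z. \<Sum>c\<in>range (grid_round L m). ?b c z) = gm m"
        unfolding gm_def using sum_grid_ind[of "\<lambda>c. w _ * apply_bcontfun (\<psi> _) c"] by auto
      finally show ?thesis .
    qed
    have g_close: "\<bar>g (x, y) - gm m (x, y)\<bar> \<le> \<bar>k m x\<bar>" for m x y
    proof -
      have "g (x, y) - gm m (x, y) = w x * (apply_bcontfun (\<psi> x) y - apply_bcontfun (\<psi> x) (grid_round L m y))"
        by (simp add: g_def gm_def right_diff_distrib)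
      then show ?thesis
        using mult_left_mono[OF grid_diff_le_osc[of "\<psi> x" y L m], of "\<bar>w x\<bar>"] grid_osc_nonneg[of L m "\<psi> x"]
        by (simp add: k_def abs_mult)
    qed
    have k_lim: "(\<lambda>m. k m x) \<longlonglongrightarrow> 0" for x
      unfolding k_def using grid_osc_tendsto_zero[OF L \<psi>] by (rule tendsto_mult_right_zero)
    have km [measurable]: "k m \<in> borel_measurable ?X" for m
      unfolding k_def using measurable_compose[OF \<psi>m grid_osc_measurable] by measurable
    have k_dom: "\<bar>k m x\<bar> \<le> \<bar>2 * (w x * norm (\<psi> x))\<bar>" for m x
      using mult_left_mono[OF grid_osc_le_norm[of L m "\<psi> x"], of "\<bar>w x\<bar>"] grid_osc_nonneg[of L m "\<psi> x"]
      by (simp add: k_def abs_mult mult_ac)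
    have kL2: "k m \<in> L2 ?X" for m
      by (rule L2_dominated(1)[OF L2_cmult[OF dom, of 2]]) (use k_dom in auto)
    have "(\<lambda>m. \<integral>x. (k m x)\<^sup>2 \<partial>?X) \<longlonglongrightarrow> (\<integral>x. 0 \<partial>?X)"
    proof (rule integral_dominated_convergence[OF _ _ L2_square[OF L2_cmult[OF dom, of 2]]])
      show "AE x in ?X. (\<lambda>m. (k m x)\<^sup>2) \<longlonglongrightarrow> 0"
        using tendsto_power[OF k_lim, of _ 2] by simp
      show "AE x in ?X. norm ((k m x)\<^sup>2) \<le> (2 * (w x * norm (\<psi> x)))\<^sup>2" for m
        using k_dom[of m] by (simp add: abs_le_square_iff)
    qed auto
    then have "(\<lambda>m. sqrt (\<integral>x. (k m x)\<^sup>2 \<partial>?X)) \<longlonglongrightarrow> 0"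
      using tendsto_real_sqrt by fastforce
    \<comment> \<open>One error sequence serves two estimates: the factor \<open>M\<close> bounds
      the error of the integrals against \<open>f (r n)\<close>, the norm of \<open>f0\<close> that
      of the limit.\<close>
    then have d_lim: "(\<lambda>m. (M + sqrt (\<integral>z. (f0 z)\<^sup>2 \<partial>?Q)) * sqrt (\<integral>x. (k m x)\<^sup>2 \<partial>?X)) \<longlonglongrightarrow> 0"
      by (rule tendsto_mult_right_zero)
    have gm_lim: "(\<lambda>m. gm m (x, y)) \<longlonglongrightarrow> g (x, y)" for x y
    proof -
      have "(\<lambda>m. g (x, y) - gm m (x, y)) \<longlonglongrightarrow> 0"
        by (rule Lim_null_comparison[OF _ tendsto_rabs_zero[OF k_lim[of x]]]) (use g_close in simp)
      from tendsto_diff[OF tendsto_const this, of "g (x, y)"] show ?thesis by simp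
    qed
    \<comment> \<open>Joint measurability of \<open>g\<close>, and next that of its traces, comes
      from pointwise approximation by the grid functions, for which it is known.\<close>
    have g_meas [measurable]: "g \<in> borel_measurable ?Q"
      by (rule borel_measurable_LIMSEQ_real[of ?Q gm])
        (use gm_lim in \<open>auto intro: L2_measurable[OF span_L2[OF gm_span]]\<close>)
    have evg_meas [measurable]: "ev n g \<in> borel_measurable ?X" for n
      by (rule borel_measurable_LIMSEQ_real[of ?X "\<lambda>m. ev n (gm m)"])
        (use gm_lim in \<open>auto simp: ev_def intro: L2_measurable[OF ev_L2[OF gm_span]]\<close>)
    have g_dom: "\<bar>g (x, y)\<bar> \<le> \<bar>w x * norm (\<psi> x)\<bar>" for x y
      by (simp add: g_def abs_mult mult_left_mono abs_bcontfun_le_norm)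
    have gL2: "g \<in> L2 ?Q"
      by (rule L2_dominated(1)[OF L2_pair_fst(1)[OF sfX finU probU dom]]) (use g_dom in auto)
    have evgL2: "ev n g \<in> L2 ?X" for n
      by (rule L2_dominated(1)[OF dom]) (use g_dom in \<open>auto simp: ev_def\<close>)
    have "(\<lambda>n. \<integral>x. f (r n) x * ev n g x \<partial>?X) \<longlonglongrightarrow> (\<integral>z. f0 z * g z \<partial>?Q)"
    proof (rule tendsto_uniform_approx[OF F[OF gm_span] _ _ d_lim])
      fix m n
      have "(\<integral>x. f (r n) x * ev n g x \<partial>?X) - (\<integral>x. f (r n) x * ev n (gm m) x \<partial>?X)
          = (\<integral>x. f (r n) x * (ev n g x - ev n (gm m) x) \<partial>?X)"
        using L2_integrable_mult[OF f evgL2, of "r n" n] L2_integrable_mult[OF f ev_L2[OF gm_span], of "r n" n m]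
        by (simp add: right_diff_distrib)
      also have "\<bar>\<dots>\<bar> \<le> M * sqrt (\<integral>x. (k m x)\<^sup>2 \<partial>?X)"
      proof (rule L2_Cauchy_Schwarz_le[OF f L2_diff[OF evgL2 ev_L2[OF gm_span]] M(2)])
        have "(\<integral>x. (ev n g x - ev n (gm m) x)\<^sup>2 \<partial>?X) \<le> (\<integral>x. (k m x)\<^sup>2 \<partial>?X)"
          by (rule L2_dominated(2)[OF kL2 L2_measurable[OF L2_diff[OF evgL2 ev_L2[OF gm_span]]]])
            (use g_close in \<open>auto simp: ev_def\<close>)
        then show "(\<integral>x. (ev n g x - ev n (gm m) x)\<^sup>2 \<partial>?X) \<le> (sqrt (\<integral>x. (k m x)\<^sup>2 \<partial>?X))\<^sup>2" by simp
      qed (use M(1) in auto)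
      also have "\<dots> \<le> (M + sqrt (\<integral>z. (f0 z)\<^sup>2 \<partial>?Q)) * sqrt (\<integral>x. (k m x)\<^sup>2 \<partial>?X)"
        by (intro mult_right_mono) auto
      finally show "\<bar>(\<integral>x. f (r n) x * ev n g x \<partial>?X) - (\<integral>x. f (r n) x * ev n (gm m) x \<partial>?X)\<bar>
        \<le> (M + sqrt (\<integral>z. (f0 z)\<^sup>2 \<partial>?Q)) * sqrt (\<integral>x. (k m x)\<^sup>2 \<partial>?X)" .
    next
      fix m
      have "(\<integral>z. f0 z * g z \<partial>?Q) - F (gm m) = (\<integral>z. f0 z * (g z - gm m z) \<partial>?Q)"
        using L2_integrable_mult[OF f0 gL2] L2_integrable_mult[OF f0 span_L2[OF gm_span]]
        by (simp add: F0[OF gm_span] right_diff_distrib)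
      also have "\<bar>\<dots>\<bar> \<le> sqrt (\<integral>z. (f0 z)\<^sup>2 \<partial>?Q) * sqrt (\<integral>x. (k m x)\<^sup>2 \<partial>?X)"
      proof (rule L2_Cauchy_Schwarz_le[OF f0 L2_diff[OF gL2 span_L2[OF gm_span]]])
        have "(\<integral>z. (g z - gm m z)\<^sup>2 \<partial>?Q) \<le> (\<integral>z. (k m (fst z))\<^sup>2 \<partial>?Q)"
          by (rule L2_dominated(2)[OF L2_pair_fst(1)[OF sfX finU probU kL2]
                L2_measurable[OF L2_diff[OF gL2 span_L2[OF gm_span]]]])
            (use g_close in auto)
        then show "(\<integral>z. (g z - gm m z)\<^sup>2 \<partial>?Q) \<le> (sqrt (\<integral>x. (k m x)\<^sup>2 \<partial>?X))\<^sup>2"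
          by (simp add: L2_pair_fst(2)[OF sfX finU probU kL2])
      qed auto
      also have "\<dots> \<le> (M + sqrt (\<integral>z. (f0 z)\<^sup>2 \<partial>?Q)) * sqrt (\<integral>x. (k m x)\<^sup>2 \<partial>?X)"
        using M(1) by (intro mult_right_mono) auto
      finally show "\<bar>(\<integral>z. f0 z * g z \<partial>?Q) - F (gm m)\<bar>
        \<le> (M + sqrt (\<integral>z. (f0 z)\<^sup>2 \<partial>?Q)) * sqrt (\<integral>x. (k m x)\<^sup>2 \<partial>?X)" .
    qed
    with gL2 show "(\<lambda>z. w (fst z) * apply_bcontfun (\<psi> (fst z)) (snd z)) \<in> L2 ?Q \<and>
      (\<lambda>n. \<integral>x. f (r n) x * (w x * apply_bcontfun (\<psi> x) ((1 / \<epsilon> (r n)) *\<^sub>R x)) \<partial>?X)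
        \<longlonglongrightarrow> (\<integral>z. f0 z * (w (fst z) * apply_bcontfun (\<psi> (fst z)) (snd z)) \<partial>?Q)"
      by (simp add: g_def[abs_def] ev_def e_def)
  qed
qed

text \<open>The limit function is built on the product of \<open>lebesgue\<close> and
  \<open>borel\<close>, whereas \<open>L2w_cell\<close> refers to Lebesgue measure on the product
  space. The point is that the preimage under \<open>fst\<close> of a subset of a null set lies in a
  null cylinder.\<close>

lemma measurable_lebesgue_pair:
  fixes f :: "'a::euclidean_space \<times> 'b::euclidean_space \<Rightarrow> real"
  assumes "f \<in> borel_measurable (lebesgue \<Otimes>\<^sub>M borel)"
  shows "f \<in> borel_measurable lebesgue"
proof -
  let ?P = "lebesgue :: ('a \<times> 'b) measure"
  have 1: "fst \<in> ?P \<rightarrow>\<^sub>M (lebesgue :: 'a measure)"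
  proof (rule measurableI)
    fix A :: "'a set" assume "A \<in> sets lebesgue"
    then obtain S N N' where A: "A = S \<union> N" "N \<subseteq> N'" "N' \<in> null_sets lborel" "S \<in> sets lborel"
      by (rule sets_completionE)
    \<comment> \<open>The second factor is infinite, but \<open>0 * \<infinity> = 0\<close> in
      \<open>ennreal\<close>.\<close>
    have "emeasure (lborel :: ('a \<times> 'b) measure) (N' \<times> UNIV) = emeasure lborel N' * emeasure lborel (UNIV :: 'b set)"
      unfolding lborel_prod[symmetric]
      by (rule lborel.emeasure_pair_measure_Times) (use A(3) in auto)
    then have null: "N' \<times> (UNIV :: 'b set) \<in> null_sets lborel"
      using A(3) by (intro null_setsI) (auto simp: borel_prod[symmetric] null_sets_def)
    have "fst -` A \<inter> space ?P = (S \<times> UNIV) \<union> (N \<times> (UNIV :: 'b set))" using A(1) by auto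
    also have "\<dots> \<in> sets ?P"
    proof (rule sets_completionI[OF refl _ null])
      show "N \<times> (UNIV :: 'b set) \<subseteq> N' \<times> UNIV" using A(2) by auto
      show "S \<times> (UNIV :: 'b set) \<in> sets lborel" using A(4) by (simp add: borel_prod[symmetric])
    qed
    finally show "fst -` A \<inter> space ?P \<in> sets ?P" .
  qed simp
  have "(\<lambda>z. (fst z, snd z)) \<in> lebesgue \<rightarrow>\<^sub>M ((lebesgue :: 'a measure) \<Otimes>\<^sub>M (borel :: 'b measure))"
    by (intro measurable_Pair 1 measurable_completion)
      (simp add: borel_measurable_continuous_onI continuous_on_snd)
  from measurable_compose[OF this assms] show ?thesis by simp
qed

section \<open>Return to Lebesgue measure on the cell and to the weighted spaces\<close>

lemma nn_integral_lebesgue_on_cell: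
  fixes h :: "real^'n \<Rightarrow> ennreal"
  assumes [measurable]: "h \<in> borel_measurable borel"
  shows "(\<integral>\<^sup>+y. h y \<partial>lebesgue_on (cell L)) = (\<integral>\<^sup>+y. h y * indicator (cell L) y \<partial>lborel)"
  by (simp add: nn_integral_restrict_space nn_integral_completion)

lemma integral_lebesgue_on_cell:
  fixes h :: "real^'n \<Rightarrow> real"
  assumes L: "L > 0" and [measurable]: "h \<in> borel_measurable borel"
  shows "(\<integral>y. h y \<partial>unif_cell L)
    = 1 / measure lebesgue (cell L :: (real^'n) set) * (\<integral>y. h y \<partial>lebesgue_on (cell L))"
proof -
  have "(\<lambda>y. indicator (cell L) y * h y) \<in> borel_measurable lborel" by measurable
  then show ?thesis
    by (simp add: integral_unif_cell[OF L] integral_restrict_space integral_completion)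
qed

theorem two_scale_compactness:
  fixes \<rho> :: "real^'n \<Rightarrow> real" and \<epsilon> :: "nat \<Rightarrow> real" and \<phi> :: "nat \<Rightarrow> real^'n \<Rightarrow> real"
  assumes L: "L > 0" and \<rho>: "\<And>x. \<rho> x \<ge> 0" and \<rho>m [measurable]: "\<rho> \<in> borel_measurable lebesgue"
    and eps: "\<And>n. \<epsilon> n > 0" "\<epsilon> \<longlonglongrightarrow> 0"
    and \<phi>: "\<And>n. \<phi> n \<in> L2w \<rho>" and bnd: "\<And>n. L2w_norm \<rho> (\<phi> n) \<le> M"
  shows "\<exists>(r::nat \<Rightarrow> nat) \<phi>0. strict_mono r \<and> \<phi>0 \<in> L2w_cell L \<rho> \<and>
    two_scale_converges L \<rho> (\<epsilon> \<circ> r) (\<phi> \<circ> r) \<phi>0"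
proof -
  let ?U = "unif_cell L :: (real^'n) measure"
  let ?X = "lebesgue :: (real^'n) measure"
  let ?Q = "?X \<Otimes>\<^sub>M ?U"
  interpret U: finite_measure ?U by (rule finite_measure_unif_cell[OF L])
  interpret X: sigma_finite_measure ?X by (rule sigma_finite_lebesgue)
  interpret Q: pair_sigma_finite ?X ?U ..
  define s where "s x = sqrt (\<rho> x)" for x
  have sm [measurable]: "s \<in> borel_measurable ?X" unfolding s_def by measurable
  have s2: "(s x)\<^sup>2 = \<rho> x" for x using \<rho> by (simp add: s_def)
  have s_mult: "s x * s x = \<rho> x" for x using s2[of x] by (simp add: power2_eq_square)
  define f where "f n x = \<phi> n x * s x" for n x
  have f2: "(f n x)\<^sup>2 = (\<phi> n x)\<^sup>2 * \<rho> x" for n x by (simp add: f_def power_mult_distrib s2)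
  have fL2: "f n \<in> L2 ?X" for n
  proof -
    have [measurable]: "\<phi> n \<in> borel_measurable ?X" using \<phi>[of n] by (simp add: L2w_def)
    have "integrable ?X (\<lambda>x. (f n x)\<^sup>2)"
      unfolding f2 by (rule integrableI_bounded) (use \<phi>[of n] \<rho> in \<open>auto simp: L2w_def\<close>)
    moreover have "f n \<in> borel_measurable ?X" unfolding f_def[abs_def] by measurable
    ultimately show ?thesis by (simp add: L2_def)
  qed
  have M0: "0 \<le> \<bar>M\<bar>" by simp
  have fM: "(\<integral>x. (f n x)\<^sup>2 \<partial>?X) \<le> \<bar>M\<bar>\<^sup>2" for n
  proof -
    have "sqrt (\<integral>x. (f n x)\<^sup>2 \<partial>?X) \<le> \<bar>M\<bar>" using bnd[of n] by (simp add: L2w_norm_def f2)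
    then show ?thesis using sqrt_le_D by blast
  qed
  obtain r :: "nat \<Rightarrow> nat" and f0 where r: "strict_mono r" and f0: "f0 \<in> L2 ?Q"
    and lim: "\<And>w \<psi>. w \<in> borel_measurable lebesgue \<Longrightarrow> \<psi> \<in> lebesgue \<rightarrow>\<^sub>M borel \<Longrightarrow> (\<And>x. \<psi> x \<in> C0per L) \<Longrightarrow>
      (\<lambda>x. w x * norm (\<psi> x)) \<in> L2 lebesgue \<Longrightarrow>
      (\<lambda>z. w (fst z) * apply_bcontfun (\<psi> (fst z)) (snd z)) \<in> L2 ?Q \<and>
      (\<lambda>n. \<integral>x. f (r n) x * (w x * apply_bcontfun (\<psi> x) ((1 / \<epsilon> (r n)) *\<^sub>R x)) \<partial>lebesgue)
        \<longlonglongrightarrow> (\<integral>z. f0 z * (w (fst z) * apply_bcontfun (\<psi> (fst z)) (snd z)) \<partial>?Q)"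
  proof (rule L2_two_scale_compactness[OF L eps fL2 M0 fM])
    fix r :: "nat \<Rightarrow> nat" and g
    assume "strict_mono r" "g \<in> L2 ?Q"
      and "\<And>w \<psi>. w \<in> borel_measurable lebesgue \<Longrightarrow> \<psi> \<in> lebesgue \<rightarrow>\<^sub>M borel \<Longrightarrow> (\<And>x. \<psi> x \<in> C0per L) \<Longrightarrow>
        (\<lambda>x. w x * norm (\<psi> x)) \<in> L2 lebesgue \<Longrightarrow>
        (\<lambda>z. w (fst z) * apply_bcontfun (\<psi> (fst z)) (snd z)) \<in> L2 ?Q \<and>
        (\<lambda>n. \<integral>x. f (r n) x * (w x * apply_bcontfun (\<psi> x) ((1 / \<epsilon> (r n)) *\<^sub>R x)) \<partial>lebesgue)
          \<longlonglongrightarrow> (\<integral>z. g z * (w (fst z) * apply_bcontfun (\<psi> (fst z)) (snd z)) \<partial>?Q)"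
    then show thesis by (rule that)
  qed
  have [measurable]: "f0 \<in> borel_measurable (?X \<Otimes>\<^sub>M borel)"
    using L2_measurable[OF f0] by (simp cong: measurable_cong_sets)
  \<comment> \<open>Undoes the multiplication by \<open>sqrt \<rho>\<close>. Where
    \<open>\<rho>\<close> vanishes, division by zero gives the value \<open>0\<close>.\<close>
  define \<phi>0 where "\<phi>0 z = f0 z / s (fst z)" for z
  have \<phi>0m [measurable]: "\<phi>0 \<in> borel_measurable (?X \<Otimes>\<^sub>M borel)" unfolding \<phi>0_def by measurable
  have sec [measurable]: "(\<lambda>y. f0 (x, y)) \<in> borel_measurable borel" for x
    by (rule measurable_compose[OF measurable_Pair1' \<open>f0 \<in> borel_measurable (?X \<Otimes>\<^sub>M borel)\<close>]) simp
  have \<phi>0_cell: "\<phi>0 \<in> L2w_cell L \<rho>"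
  proof -
    have "(\<integral>\<^sup>+x. (\<integral>\<^sup>+y. ennreal ((\<phi>0 (x, y))\<^sup>2 * \<rho> x) \<partial>lebesgue_on (cell L)) \<partial>?X)
        \<le> (\<integral>\<^sup>+x. emeasure lborel (cell L :: (real^'n) set) * (\<integral>\<^sup>+y. ennreal ((f0 (x, y))\<^sup>2) \<partial>?U) \<partial>?X)"
    proof (rule nn_integral_mono)
      fix x :: "real^'n"
      have "(\<phi>0 (x, y))\<^sup>2 * \<rho> x \<le> (f0 (x, y))\<^sup>2" for y
        by (cases "s x = 0") (auto simp: \<phi>0_def power_divide s2[symmetric])
      then have "(\<integral>\<^sup>+y. ennreal ((\<phi>0 (x, y))\<^sup>2 * \<rho> x) \<partial>lebesgue_on (cell L))
          \<le> (\<integral>\<^sup>+y. ennreal ((f0 (x, y))\<^sup>2) \<partial>lebesgue_on (cell L))"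
        by (intro nn_integral_mono ennreal_leI)
      also have "\<dots> = (\<integral>\<^sup>+y. ennreal ((f0 (x, y))\<^sup>2) * indicator (cell L) y \<partial>lborel)"
        by (rule nn_integral_lebesgue_on_cell) measurable
      also have "\<dots> = emeasure lborel (cell L :: (real^'n) set) * (\<integral>\<^sup>+y. ennreal ((f0 (x, y))\<^sup>2) \<partial>?U)"
      proof -
        \<comment> \<open>Cancellation in \<open>ennreal\<close> requires that the measure of the
          cell be neither zero nor infinite.\<close>
        have cancel: "c * (I / c) = I" if "c \<noteq> 0" "c \<noteq> top" for c I :: ennreal
          using that by (simp add: ennreal_times_divide ennreal_mult_divide_eq mult.commute)
        show ?thesis
          using measure_cell_pos[OF L, where 'n='n]
          by (subst nn_integral_uniform_measure, simp, simp, subst cancel) (auto simp: emeasure_cell)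
      qed
      finally show "(\<integral>\<^sup>+y. ennreal ((\<phi>0 (x, y))\<^sup>2 * \<rho> x) \<partial>lebesgue_on (cell L))
          \<le> emeasure lborel (cell L :: (real^'n) set) * (\<integral>\<^sup>+y. ennreal ((f0 (x, y))\<^sup>2) \<partial>?U)" .
    qed
    also have "\<dots> = emeasure lborel (cell L :: (real^'n) set) * (\<integral>\<^sup>+x. (\<integral>\<^sup>+y. ennreal ((f0 (x, y))\<^sup>2) \<partial>?U) \<partial>?X)"
      by (rule nn_integral_cmult) measurable
    also have "(\<integral>\<^sup>+x. (\<integral>\<^sup>+y. ennreal ((f0 (x, y))\<^sup>2) \<partial>?U) \<partial>?X) = (\<integral>\<^sup>+z. ennreal ((f0 z)\<^sup>2) \<partial>?Q)"
      by (rule U.nn_integral_fst) (use L2_measurable[OF f0] in measurable)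
    also have "\<dots> = ennreal (\<integral>z. (f0 z)\<^sup>2 \<partial>?Q)"
      by (rule nn_integral_eq_integral[OF L2_square[OF f0]]) simp
    also have "emeasure lborel (cell L :: (real^'n) set) * ennreal (\<integral>z. (f0 z)\<^sup>2 \<partial>?Q) < \<infinity>"
      by (subst emeasure_cell) (simp add: ennreal_mult_less_top)
    finally show ?thesis
      using measurable_lebesgue_pair[OF \<phi>0m] by (auto simp: L2w_cell_def intro: measurable_restrict_space1)
  qed
  have "two_scale_converges L \<rho> (\<epsilon> \<circ> r) (\<phi> \<circ> r) \<phi>0"
    unfolding two_scale_converges_def
  proof (intro conjI ballI allI)
    show "(\<phi> \<circ> r) n \<in> L2w \<rho>" for n using \<phi> by simp
    show "\<phi>0 \<in> L2w_cell L \<rho>" by (rule \<phi>0_cell)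
    fix \<psi> assume \<psi>_in: "\<psi> \<in> L2w_C0per L \<rho>"
    then have \<psi>m [measurable]: "\<psi> \<in> ?X \<rightarrow>\<^sub>M borel" and \<psi>C: "\<And>x. \<psi> x \<in> C0per L"
      and \<psi>fin: "(\<integral>\<^sup>+x. ennreal ((SUP y\<in>cell L. \<bar>apply_bcontfun (\<psi> x) y\<bar>\<^sup>2) * \<rho> x) \<partial>?X) < \<infinity>"
      by (auto simp: L2w_C0per_def measurable_restrict_space2_iff)
    have nm [measurable]: "(\<lambda>x. norm (\<psi> x)) \<in> borel_measurable ?X"
      by (rule measurable_compose[OF \<psi>m]) (intro borel_measurable_continuous_onI continuous_intros)
    \<comment> \<open>The norm of \<open>\<psi> x\<close> is a supremum over the whole space; by
      periodicity it is controlled by the supremum over the cell that the test space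
      prescribes.\<close>
    have norm_le: "(norm (\<psi> x))\<^sup>2 \<le> (SUP y\<in>cell L. \<bar>apply_bcontfun (\<psi> x) y\<bar>\<^sup>2)" (is "_ \<le> ?S") for x
    proof -
      have le: "\<bar>apply_bcontfun (\<psi> x) y\<bar>\<^sup>2 \<le> ?S" for y
      proof -
        have "apply_bcontfun (\<psi> x) (period_rem L y) = apply_bcontfun (\<psi> x) y"
          using \<psi>C[of x] by (intro periodic_period_rem[OF L]) (simp add: C0per_def)
        moreover have "\<bar>apply_bcontfun (\<psi> x) (period_rem L y)\<bar>\<^sup>2 \<le> ?S"
        proof (rule cSUP_upper[OF period_rem_in_cell[OF L]])
          show "bdd_above ((\<lambda>y. \<bar>apply_bcontfun (\<psi> x) y\<bar>\<^sup>2) ` cell L)"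
            by (rule bdd_aboveI2[of _ _ "(norm (\<psi> x))\<^sup>2"]) (intro power_mono abs_bcontfun_le_norm abs_ge_zero)
        qed
        ultimately show ?thesis by simp
      qed
      then have "\<bar>apply_bcontfun (\<psi> x) y\<bar> \<le> sqrt ?S" for y by (intro real_le_rsqrt)
      then have "norm (\<psi> x) \<le> sqrt ?S" by (intro norm_bound) simp
      moreover have "0 \<le> ?S" using le[of 0] by (rule order_trans[rotated]) simp
      ultimately show ?thesis using power_mono[of "norm (\<psi> x)" "sqrt ?S" 2] by simp
    qed
    have dom: "(\<lambda>x. s x * norm (\<psi> x)) \<in> L2 ?X"
    proof -
      have "(\<integral>\<^sup>+x. ennreal (norm ((s x * norm (\<psi> x))\<^sup>2)) \<partial>?X)
          \<le> (\<integral>\<^sup>+x. ennreal ((SUP y\<in>cell L. \<bar>apply_bcontfun (\<psi> x) y\<bar>\<^sup>2) * \<rho> x) \<partial>?X)"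
        by (intro nn_integral_mono ennreal_leI)
          (use norm_le \<rho> in \<open>auto simp: power_mult_distrib s2 mult.commute intro: mult_left_mono\<close>)
      with \<psi>fin have "integrable ?X (\<lambda>x. (s x * norm (\<psi> x))\<^sup>2)"
        by (intro integrableI_bounded) (auto intro: le_less_trans)
      then show ?thesis by (simp add: L2_def)
    qed
    let ?g = "\<lambda>z. s (fst z) * apply_bcontfun (\<psi> (fst z)) (snd z)"
    from lim[OF sm \<psi>m \<psi>C dom] have gL2: "?g \<in> L2 ?Q"
      and conv: "(\<lambda>n. \<integral>x. f (r n) x * (s x * apply_bcontfun (\<psi> x) ((1 / \<epsilon> (r n)) *\<^sub>R x)) \<partial>lebesgue)
        \<longlonglongrightarrow> (\<integral>z. f0 z * ?g z \<partial>?Q)" by blast+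
    have "(\<integral>z. f0 z * ?g z \<partial>?Q) = (\<integral>x. \<integral>y. f0 (x, y) * ?g (x, y) \<partial>?U \<partial>?X)"
      using Q.integral_fst'[OF L2_integrable_mult[OF f0 gL2]] by simp
    also have "\<dots> = (\<integral>x. 1 / measure lebesgue (cell L :: (real^'n) set) *
        (\<integral>y. \<phi>0 (x, y) * apply_bcontfun (\<psi> x) y * \<rho> x \<partial>lebesgue_on (cell L)) \<partial>?X)"
    proof (rule Bochner_Integration.integral_cong[OF refl])
      fix x :: "real^'n"
      have [measurable]: "apply_bcontfun (\<psi> x) \<in> borel_measurable borel"
        by (intro borel_measurable_continuous_onI) simp
      \<comment> \<open>If \<open>s x = 0\<close> then both sides are zero: \<open>?g\<close>
        contains the factor \<open>s x\<close>, and \<open>\<rho> x\<close> is its square.\<close>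
      have "f0 (x, y) * ?g (x, y) = \<phi>0 (x, y) * apply_bcontfun (\<psi> x) y * \<rho> x" for y
        by (cases "s x = 0") (auto simp: \<phi>0_def s_mult[symmetric])
      moreover have "(\<integral>y. f0 (x, y) * ?g (x, y) \<partial>?U) = 1 / measure lebesgue (cell L :: (real^'n) set) *
          (\<integral>y. f0 (x, y) * ?g (x, y) \<partial>lebesgue_on (cell L))"
        by (rule integral_lebesgue_on_cell[OF L]) simp
      ultimately show "(\<integral>y. f0 (x, y) * ?g (x, y) \<partial>?U) = 1 / measure lebesgue (cell L :: (real^'n) set) *
          (\<integral>y. \<phi>0 (x, y) * apply_bcontfun (\<psi> x) y * \<rho> x \<partial>lebesgue_on (cell L))"
        by (simp only:)
    qed
    also have "\<dots> = 1 / measure lebesgue (cell L :: (real^'n) set) *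
        (\<integral>x. \<integral>y. \<phi>0 (x, y) * apply_bcontfun (\<psi> x) y * \<rho> x \<partial>lebesgue_on (cell L) \<partial>?X)"
      by (rule integral_mult_right_zero)
    finally have rhs: "(\<integral>z. f0 z * ?g z \<partial>?Q) = \<dots>" .
    have lhs: "f (r n) x * (s x * apply_bcontfun (\<psi> x) ((1 / \<epsilon> (r n)) *\<^sub>R x))
        = (\<phi> \<circ> r) n x * apply_bcontfun (\<psi> x) ((1 / (\<epsilon> \<circ> r) n) *\<^sub>R x) * \<rho> x" for n x
      by (simp add: f_def s_mult[symmetric])
    show "(\<lambda>n. \<integral>x. (\<phi> \<circ> r) n x * apply_bcontfun (\<psi> x) ((1 / (\<epsilon> \<circ> r) n) *\<^sub>R x) * \<rho> x \<partial>?X)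
        \<longlonglongrightarrow> 1 / measure lebesgue (cell L :: (real^'n) set) *
          (\<integral>x. \<integral>y. \<phi>0 (x, y) * apply_bcontfun (\<psi> x) y * \<rho> x \<partial>lebesgue_on (cell L) \<partial>?X)"
      using conv unfolding rhs lhs .
  qed
  with r \<phi>0_cell show ?thesis by blast
qed

theorem proposition3p8:
  fixes V :: "real^'n \<Rightarrow> real"
    and \<sigma> L a b :: real
    and \<epsilon> :: "nat \<Rightarrow> real"
    and \<phi> :: "nat \<Rightarrow> real^'n \<Rightarrow> real"
  assumes "\<sigma> > 0" and "L > 0"
    and "smooth V"
    and "poly_bounded_above V"
    and "bdd_below (range V)"
    and "a > 0" and "b > 0"
    and "\<And>x. - (grad V x \<bullet> x) \<le> a - b * (norm x)\<^sup>2"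
    and "\<And>n. \<epsilon> n > 0" and "\<epsilon> \<longlonglongrightarrow> 0"
    and "\<And>n. \<phi> n \<in> L2w (gibbs \<sigma> V)"
    and "\<exists>M. \<forall>n. L2w_norm (gibbs \<sigma> V) (\<phi> n) \<le> M"
  shows "\<exists>(r::nat \<Rightarrow> nat) \<phi>0. strict_mono r \<and> \<phi>0 \<in> L2w_cell L (gibbs \<sigma> V) \<and>
           two_scale_converges L (gibbs \<sigma> V) (\<epsilon> \<circ> r) (\<phi> \<circ> r) \<phi>0"
proof -
  obtain M where M: "\<And>n. L2w_norm (gibbs \<sigma> V) (\<phi> n) \<le> M" using assms(12) by blast
  \<comment> \<open>The zeroth level of smoothness is continuity, which makes the Gibbs density
    Borel. Its normalising factor is the reciprocal of the integral of a nonnegative function, so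
    the density is nonnegative.\<close>
  have "Ck 0 V" using assms(3) by (simp only: smooth_def)
  then have [measurable]: "V \<in> borel_measurable borel" by (simp add: borel_measurable_continuous_onI)
  have "gibbs \<sigma> V \<in> borel_measurable lborel"
    unfolding gibbs_def[abs_def] by measurable
  then have "gibbs \<sigma> V \<in> borel_measurable lebesgue" by (rule measurable_completion)
  moreover have "gibbs \<sigma> V x \<ge> 0" for x unfolding gibbs_def by simp
  ultimately show ?thesis
    by (intro two_scale_compactness[OF assms(2) _ _ assms(9,10,11), of _ M] M)
qed

end
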